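(* If the color classes form a laminar family, then each of the problems Exact-Simultaneous-Dipaths, Exact-Simultaneous-Paths, Superset-Simultaneous-Dipaths, and Superset-Simultaneous-Paths is polynomial-time solvable.
   Context: Directed problems: the input is a positive integer $k$, a digraph $D=(V,A)$ with $A=A_1\cup\cdots\cup A_k$ (the color classes $A_i$ are not necessarily disjoint), two distinct vertices $s,t\in V$, and a conservative cost function $c\colon A\to\mathbb{R}$ (no directed cycle of negative total cost). In Exact-Simultaneous-Dipaths (respectively Superset-Simultaneous-Dipaths), the task is to find $A'\subseteq A$ of minimum cost $\sum_{a\in A'}c(a)$ such that $A'\cap A_i$ is exactly the arc set of (respectively contains the arc set of) an $s$-$t$ dipath for all $i\in\{1,\ldots,k\}$, or to determine that no such $A'$ exists. Undirected problems: the input is a positive integer $k$, an undirected graph $G=(V,E)$ with $E=E_1\cup\cdots\cup E_k$ (color classes $E_i$, not necessarily disjoint), two distinct vertices $s,t\in V$, and a nonnegative cost function $c\colon E\to\mathbb{R}_+$. In Exact-Simultaneous-Paths (respectively Superset-Simultaneous-Paths), the task is to find $E'\subseteq E$ of minimum cost such that $E'\cap E_i$ is exactly the edge set of (respectively contains the edge set of) an $s$-$t$ path for all $i\in\{1,\ldots,k\}$, or to determine that no such $E'$ exists. Paths and dipaths have no repeated vertices. Graphs and digraphs are finite and may have parallel edges or arcs. A set family on a finite ground set is laminar if, for any two of its intersecting sets, one is contained in the other. The number $k$ is part of the input. *)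

theory Defs
  imports
    Complex_Main
    "HOL-Library.Log_Nat"
    "HOL-Computational_Algebra.Polynomial"
    "Graph_Theory.Digraph"
    "Graph_Theory.Arc_Walk"
begin

section \<open>Simultaneous paths\<close>

definition laminar :: "'a set set \<Rightarrow> bool" where
  "laminar F \<longleftrightarrow> (\<forall>X\<in>F. \<forall>Y\<in>F. X \<inter> Y \<noteq> {} \<longrightarrow> X \<subseteq> Y \<or> Y \<subseteq> X)"

text \<open>Digraphs and dipaths are those of \<^theory>\<open>Graph_Theory.Digraph\<close> and
  \<^theory>\<open>Graph_Theory.Arc_Walk\<close>: parallel arcs are allowed, an \<open>apath\<close> repeats no vertex, and a
  \<open>cycle\<close> is a nonempty closed walk repeating no vertex (a loop is a cycle).\<close>

definition conservative :: "('v, 'e) pre_digraph \<Rightarrow> ('e \<Rightarrow> 'n::linordered_idom) \<Rightarrow> bool" where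
  "conservative D c \<longleftrightarrow> (\<forall>p. pre_digraph.cycle D p \<longrightarrow> 0 \<le> sum_list (map c p))"

record ('v, 'e) ugraph =
  uverts :: "'v set"
  uedges :: "'e set"
  uends :: "'e \<Rightarrow> 'v set"

definition fin_ugraph :: "('v, 'e) ugraph \<Rightarrow> bool" where
  "fin_ugraph G \<longleftrightarrow> finite (uverts G) \<and> finite (uedges G) \<and>
     (\<forall>e\<in>uedges G. \<exists>u\<in>uverts G. \<exists>v\<in>uverts G. uends G e = {u, v})"

definition upath :: "('v, 'e) ugraph \<Rightarrow> 'v \<Rightarrow> 'e list \<Rightarrow> 'v \<Rightarrow> bool" where
  "upath G s p t \<longleftrightarrow>
     (\<exists>vs. length vs = Suc (length p) \<and> set vs \<subseteq> uverts G \<and> set p \<subseteq> uedges G \<and>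
           distinct vs \<and> hd vs = s \<and> last vs = t \<and>
           (\<forall>i < length p. uends G (p ! i) = {vs ! i, vs ! Suc i}))"

text \<open>In the following, \<open>C i\<close> for \<open>i < k\<close> are the color classes.\<close>

definition exact_dipaths ::
    "('v, 'e) pre_digraph \<Rightarrow> nat \<Rightarrow> (nat \<Rightarrow> 'e set) \<Rightarrow> 'v \<Rightarrow> 'v \<Rightarrow> 'e set \<Rightarrow> bool" where
  "exact_dipaths D k C s t A' \<longleftrightarrow>
     A' \<subseteq> arcs D \<and> (\<forall>i<k. \<exists>p. pre_digraph.apath D s p t \<and> A' \<inter> C i = set p)"

definition superset_dipaths ::
    "('v, 'e) pre_digraph \<Rightarrow> nat \<Rightarrow> (nat \<Rightarrow> 'e set) \<Rightarrow> 'v \<Rightarrow> 'v \<Rightarrow> 'e set \<Rightarrow> bool" where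
  "superset_dipaths D k C s t A' \<longleftrightarrow>
     A' \<subseteq> arcs D \<and> (\<forall>i<k. \<exists>p. pre_digraph.apath D s p t \<and> set p \<subseteq> A' \<inter> C i)"

definition exact_paths ::
    "('v, 'e) ugraph \<Rightarrow> nat \<Rightarrow> (nat \<Rightarrow> 'e set) \<Rightarrow> 'v \<Rightarrow> 'v \<Rightarrow> 'e set \<Rightarrow> bool" where
  "exact_paths G k C s t E' \<longleftrightarrow>
     E' \<subseteq> uedges G \<and> (\<forall>i<k. \<exists>p. upath G s p t \<and> E' \<inter> C i = set p)"

definition superset_paths ::
    "('v, 'e) ugraph \<Rightarrow> nat \<Rightarrow> (nat \<Rightarrow> 'e set) \<Rightarrow> 'v \<Rightarrow> 'v \<Rightarrow> 'e set \<Rightarrow> bool" where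
  "superset_paths G k C s t E' \<longleftrightarrow>
     E' \<subseteq> uedges G \<and> (\<forall>i<k. \<exists>p. upath G s p t \<and> set p \<subseteq> E' \<inter> C i)"

text \<open>Correct answers of a minimization problem over sets, where a set is reported as a list of its
  elements and \<open>None\<close> reports infeasibility.\<close>

definition solves ::
    "('e set \<Rightarrow> bool) \<Rightarrow> ('e \<Rightarrow> 'n::linordered_idom) \<Rightarrow> 'e list option \<Rightarrow> bool" where
  "solves feasible c ans \<longleftrightarrow>
     (case ans of
        None \<Rightarrow> \<not> (\<exists>X. feasible X)
      | Some xs \<Rightarrow> feasible (set xs) \<and> (\<forall>X. feasible X \<longrightarrow> sum c (set xs) \<le> sum c X))"


section \<open>Inputs\<close>

text \<open>Vertices are \<open>0, \<dots>, vertex_count - 1\<close>. Entry \<open>j\<close> of the arc table holds tail, head and cost of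
  arc \<open>j\<close>; for the undirected problems, it holds the two ends of edge \<open>j\<close> in any order, and its cost.
  Entry \<open>i\<close> of \<open>color_lists\<close> lists the members of the \<open>i\<close>-th color class, so \<open>k\<close> is the length of
  that list.\<close>

record 'n sim_input =
  vertex_count :: nat
  arc_table :: "(nat \<times> nat \<times> 'n) list"
  color_lists :: "nat list list"
  source :: nat
  target :: nat

definition digraph_of :: "'n sim_input \<Rightarrow> (nat, nat) pre_digraph" where
  "digraph_of I =
     \<lparr> verts = {..<vertex_count I}, arcs = {..<length (arc_table I)},
       tail = (\<lambda>j. fst (arc_table I ! j)), head = (\<lambda>j. fst (snd (arc_table I ! j))) \<rparr>"

definition ugraph_of :: "'n sim_input \<Rightarrow> (nat, nat) ugraph" where
  "ugraph_of I =
     \<lparr> uverts = {..<vertex_count I}, uedges = {..<length (arc_table I)},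
       uends = (\<lambda>j. {fst (arc_table I ! j), fst (snd (arc_table I ! j))}) \<rparr>"

definition cost_of :: "'n sim_input \<Rightarrow> nat \<Rightarrow> 'n" where
  "cost_of I j = snd (snd (arc_table I ! j))"

definition num_colors :: "'n sim_input \<Rightarrow> nat" where
  "num_colors I = length (color_lists I)"

definition color_class :: "'n sim_input \<Rightarrow> nat \<Rightarrow> nat set" where
  "color_class I i = set (color_lists I ! i)"

definition color_family :: "'n sim_input \<Rightarrow> nat set set" where
  "color_family I = color_class I ` {..<num_colors I}"

definition directed_input :: "'n::linordered_idom sim_input \<Rightarrow> bool" where
  "directed_input I \<longleftrightarrow>
     num_colors I > 0 \<and>
     fin_digraph (digraph_of I) \<and>
     (\<Union>i<num_colors I. color_class I i) = arcs (digraph_of I) \<and>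
     source I \<in> verts (digraph_of I) \<and> target I \<in> verts (digraph_of I) \<and> source I \<noteq> target I \<and>
     conservative (digraph_of I) (cost_of I)"

definition undirected_input :: "'n::linordered_idom sim_input \<Rightarrow> bool" where
  "undirected_input I \<longleftrightarrow>
     num_colors I > 0 \<and>
     fin_ugraph (ugraph_of I) \<and>
     (\<Union>i<num_colors I. color_class I i) = uedges (ugraph_of I) \<and>
     source I \<in> uverts (ugraph_of I) \<and> target I \<in> uverts (ugraph_of I) \<and> source I \<noteq> target I \<and>
     (\<forall>e\<in>uedges (ugraph_of I). 0 \<le> cost_of I e)"

text \<open>The four problems, as relations between inputs and correct answers.\<close>

definition Exact_Simultaneous_Dipaths ::
    "'n::linordered_idom sim_input \<Rightarrow> nat list option \<Rightarrow> bool" where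
  "Exact_Simultaneous_Dipaths I =
     solves (exact_dipaths (digraph_of I) (num_colors I) (color_class I) (source I) (target I))
       (cost_of I)"

definition Superset_Simultaneous_Dipaths ::
    "'n::linordered_idom sim_input \<Rightarrow> nat list option \<Rightarrow> bool" where
  "Superset_Simultaneous_Dipaths I =
     solves (superset_dipaths (digraph_of I) (num_colors I) (color_class I) (source I) (target I))
       (cost_of I)"

definition Exact_Simultaneous_Paths ::
    "'n::linordered_idom sim_input \<Rightarrow> nat list option \<Rightarrow> bool" where
  "Exact_Simultaneous_Paths I =
     solves (exact_paths (ugraph_of I) (num_colors I) (color_class I) (source I) (target I))
       (cost_of I)"

definition Superset_Simultaneous_Paths ::
    "'n::linordered_idom sim_input \<Rightarrow> nat list option \<Rightarrow> bool" where
  "Superset_Simultaneous_Paths I =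
     solves (superset_paths (ugraph_of I) (num_colors I) (color_class I) (source I) (target I))
       (cost_of I)"


section \<open>Model of computation\<close>

text \<open>A while language over binary trees whose leaves may carry numbers. Every evaluation of a
  subexpression is charged the full size of its value (shared subtrees are counted repeatedly), where
  a number \<open>q\<close> contributes \<open>sz q\<close> to the size.

  \<^item> For rational numbers and \<open>sz = bit_size\<close> this is a logarithmic-cost model: a step is charged at
    least the number of bits it reads and writes, so that running times agree with those of Turing
    machines (numbers in binary) up to a polynomial.
  \<^item> For real numbers and \<open>sz = unit_size\<close> it is a real random-access model in which a number has unit
    size and additions, subtractions and comparisons are the only arithmetic; programs contain no
    number constants but 0 and 1, and there is no multiplication, division or rounding that could be
    abused to compress data into a number.\<close>

datatype 'n val = Leaf | Num 'n | Node "'n val" "'n val"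

primrec val_size :: "('n \<Rightarrow> nat) \<Rightarrow> 'n val \<Rightarrow> nat" where
  "val_size sz Leaf = 1"
| "val_size sz (Num q) = Suc (sz q)"
| "val_size sz (Node v w) = Suc (val_size sz v + val_size sz w)"

definition bit_size :: "rat \<Rightarrow> nat" where
  "bit_size q = (case quotient_of q of (a, b) \<Rightarrow> floorlog 2 (nat \<bar>a\<bar>) + floorlog 2 (nat b))"

definition unit_size :: "real \<Rightarrow> nat" where
  "unit_size _ = 1"

datatype expr =
    Var nat | NilE | ZeroE | OneE
  | ConsE expr expr | HdE expr | TlE expr
  | AddE expr expr | SubE expr expr
  | LessE expr expr | EqE expr expr | IsNodeE expr

text \<open>\<open>Leaf\<close> is the truth value false, everything else counts as true. Ill-typed operations yield
  \<open>Leaf\<close>.\<close>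

definition truth :: "bool \<Rightarrow> 'n val" where
  "truth b = (if b then Node Leaf Leaf else Leaf)"

fun left :: "'n val \<Rightarrow> 'n val" where
  "left (Node v w) = v"
| "left _ = Leaf"

fun right :: "'n val \<Rightarrow> 'n val" where
  "right (Node v w) = w"
| "right _ = Leaf"

fun is_node :: "'n val \<Rightarrow> bool" where
  "is_node (Node v w) = True"
| "is_node _ = False"

fun num_op :: "('n \<Rightarrow> 'n \<Rightarrow> 'n val) \<Rightarrow> 'n val \<Rightarrow> 'n val \<Rightarrow> 'n val" where
  "num_op f (Num x) (Num y) = f x y"
| "num_op f _ _ = Leaf"

type_synonym 'n state = "nat \<Rightarrow> 'n val"

primrec eval_expr :: "expr \<Rightarrow> 'n::linordered_idom state \<Rightarrow> 'n val" where
  "eval_expr (Var x) \<sigma> = \<sigma> x"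
| "eval_expr NilE \<sigma> = Leaf"
| "eval_expr ZeroE \<sigma> = Num 0"
| "eval_expr OneE \<sigma> = Num 1"
| "eval_expr (ConsE e f) \<sigma> = Node (eval_expr e \<sigma>) (eval_expr f \<sigma>)"
| "eval_expr (HdE e) \<sigma> = left (eval_expr e \<sigma>)"
| "eval_expr (TlE e) \<sigma> = right (eval_expr e \<sigma>)"
| "eval_expr (AddE e f) \<sigma> = num_op (\<lambda>x y. Num (x + y)) (eval_expr e \<sigma>) (eval_expr f \<sigma>)"
| "eval_expr (SubE e f) \<sigma> = num_op (\<lambda>x y. Num (x - y)) (eval_expr e \<sigma>) (eval_expr f \<sigma>)"
| "eval_expr (LessE e f) \<sigma> = num_op (\<lambda>x y. truth (x < y)) (eval_expr e \<sigma>) (eval_expr f \<sigma>)"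
| "eval_expr (EqE e f) \<sigma> = truth (eval_expr e \<sigma> = eval_expr f \<sigma>)"
| "eval_expr (IsNodeE e) \<sigma> = truth (is_node (eval_expr e \<sigma>))"

primrec subexprs :: "expr \<Rightarrow> expr list" where
  "subexprs (Var x) = [Var x]"
| "subexprs NilE = [NilE]"
| "subexprs ZeroE = [ZeroE]"
| "subexprs OneE = [OneE]"
| "subexprs (ConsE e f) = ConsE e f # subexprs e @ subexprs f"
| "subexprs (HdE e) = HdE e # subexprs e"
| "subexprs (TlE e) = TlE e # subexprs e"
| "subexprs (AddE e f) = AddE e f # subexprs e @ subexprs f"
| "subexprs (SubE e f) = SubE e f # subexprs e @ subexprs f"
| "subexprs (LessE e f) = LessE e f # subexprs e @ subexprs f"
| "subexprs (EqE e f) = EqE e f # subexprs e @ subexprs f"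
| "subexprs (IsNodeE e) = IsNodeE e # subexprs e"

definition expr_time :: "('n::linordered_idom \<Rightarrow> nat) \<Rightarrow> expr \<Rightarrow> 'n state \<Rightarrow> nat" where
  "expr_time sz e \<sigma> = (\<Sum>f\<leftarrow>subexprs e. val_size sz (eval_expr f \<sigma>))"

datatype com =
    SkipC | AssignC nat expr | SeqC com com | IfC expr com com | WhileC expr com

text \<open>\<open>exec sz c \<sigma> n \<tau>\<close>: started in state \<open>\<sigma>\<close>, program \<open>c\<close> halts in state \<open>\<tau>\<close> after time \<open>n\<close>.\<close>

inductive exec ::
    "('n::linordered_idom \<Rightarrow> nat) \<Rightarrow> com \<Rightarrow> 'n state \<Rightarrow> nat \<Rightarrow> 'n state \<Rightarrow> bool" for sz where
  skip: "exec sz SkipC \<sigma> 1 \<sigma>"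
| assign: "exec sz (AssignC x e) \<sigma> (1 + expr_time sz e \<sigma>) (\<sigma>(x := eval_expr e \<sigma>))"
| seq: "exec sz c \<sigma> m \<rho> \<Longrightarrow> exec sz d \<rho> n \<tau> \<Longrightarrow> exec sz (SeqC c d) \<sigma> (m + n) \<tau>"
| if_true: "eval_expr e \<sigma> \<noteq> Leaf \<Longrightarrow> exec sz c \<sigma> n \<tau> \<Longrightarrow>
    exec sz (IfC e c d) \<sigma> (1 + expr_time sz e \<sigma> + n) \<tau>"
| if_false: "eval_expr e \<sigma> = Leaf \<Longrightarrow> exec sz d \<sigma> n \<tau> \<Longrightarrow>
    exec sz (IfC e c d) \<sigma> (1 + expr_time sz e \<sigma> + n) \<tau>"
| while_false: "eval_expr e \<sigma> = Leaf \<Longrightarrow> exec sz (WhileC e c) \<sigma> (1 + expr_time sz e \<sigma>) \<sigma>"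
| while_true: "eval_expr e \<sigma> \<noteq> Leaf \<Longrightarrow> exec sz c \<sigma> m \<rho> \<Longrightarrow> exec sz (WhileC e c) \<rho> n \<tau> \<Longrightarrow>
    exec sz (WhileC e c) \<sigma> (1 + expr_time sz e \<sigma> + m + n) \<tau>"

inductive_cases skipE: "exec sz SkipC \<sigma> n \<tau>"
inductive_cases assignE: "exec sz (AssignC x e) \<sigma> n \<tau>"
inductive_cases seqE: "exec sz (SeqC c d) \<sigma> n \<tau>"
inductive_cases ifE: "exec sz (IfC e c d) \<sigma> n \<tau>"
inductive_cases whileE: "exec sz (WhileC e c) \<sigma> n \<tau>"

lemma exec_deterministic:
  assumes "exec sz c \<sigma> n \<tau>" and "exec sz c \<sigma> n' \<tau>'"
  shows "n = n' \<and> \<tau> = \<tau>'"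
  using assms
proof (induction arbitrary: n' \<tau>' rule: exec.induct)
  case (skip \<sigma>)
  then show ?case by (auto elim: skipE)
next
  case (assign x e \<sigma>)
  then show ?case by (auto elim: assignE)
next
  case (seq c \<sigma> m \<rho> d n \<tau>)
  from seq.prems show ?case by (rule seqE) (metis seq.IH)
next
  case (if_true e \<sigma> c n \<tau> d)
  from if_true.prems show ?case by (rule ifE) (use if_true.hyps(1) if_true.IH in force)+
next
  case (if_false e \<sigma> d n \<tau> c)
  from if_false.prems show ?case by (rule ifE) (use if_false.hyps(1) if_false.IH in force)+
next
  case (while_false e \<sigma> c)
  from while_false.prems show ?case by (rule whileE) (use while_false.hyps in simp_all)
next
  case (while_true e \<sigma> c m \<rho> n \<tau>)
  from while_true.prems show ?case
  proof (rule whileE)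
    fix m1 \<rho>1 n1
    assume *: "exec sz c \<sigma> m1 \<rho>1" "exec sz (WhileC e c) \<rho>1 n1 \<tau>'"
      and n': "n' = Suc (expr_time sz e \<sigma> + m1 + n1)"
    from while_true.IH(1)[OF *(1)] have eq: "m = m1" "\<rho> = \<rho>1" by simp_all
    from while_true.IH(2) *(2) have "n = n1 \<and> \<tau> = \<tau>'" unfolding eq by simp
    then show ?thesis using n' eq by simp
  qed (use while_true.hyps(1) in simp_all)
qed


section \<open>Polynomial-time solvability\<close>

definition enc_list :: "'n val list \<Rightarrow> 'n val" where
  "enc_list vs = foldr Node vs Leaf"

definition enc_nat :: "nat \<Rightarrow> 'n::linordered_idom val" where
  "enc_nat n = Num (of_nat n)"

text \<open>The vertices are listed one by one, so the encoding of a graph with \<open>n\<close> vertices has size at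
  least \<open>n\<close>.\<close>

definition enc_input :: "'n::linordered_idom sim_input \<Rightarrow> 'n val" where
  "enc_input I = enc_list
     [enc_list (map enc_nat [0..<vertex_count I]),
      enc_list (map (\<lambda>j. case arc_table I ! j of (u, v, q) \<Rightarrow>
          enc_list [enc_nat j, enc_nat u, enc_nat v, Num q]) [0..<length (arc_table I)]),
      enc_list (map (\<lambda>C. enc_list (map enc_nat C)) (color_lists I)),
      enc_nat (source I),
      enc_nat (target I)]"

definition enc_answer :: "nat list option \<Rightarrow> 'n::linordered_idom val" where
  "enc_answer ans = (case ans of None \<Rightarrow> Leaf | Some xs \<Rightarrow> enc_list [enc_list (map enc_nat xs)])"

text \<open>Inputs are subject to a promise \<open>P\<close>. Variable 0 holds the encoded input at the start and the
  encoded answer at the end; all other variables start as \<open>Leaf\<close>.\<close>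

definition polytime_solvable ::
    "('n::linordered_idom \<Rightarrow> nat) \<Rightarrow> ('n sim_input \<Rightarrow> bool) \<Rightarrow>
     ('n sim_input \<Rightarrow> nat list option \<Rightarrow> bool) \<Rightarrow> bool" where
  "polytime_solvable sz P problem \<longleftrightarrow>
     (\<exists>(c :: com) (p :: nat poly). \<forall>I. P I \<longrightarrow>
        (\<exists>n \<tau> ans. exec sz c ((\<lambda>_. Leaf)(0 := enc_input I)) n \<tau> \<and>
                  n \<le> poly p (val_size sz (enc_input I)) \<and>
                  \<tau> 0 = enc_answer ans \<and> problem I ans))"

definition laminar_directed_input :: "'n::linordered_idom sim_input \<Rightarrow> bool" where
  "laminar_directed_input I \<longleftrightarrow> directed_input I \<and> laminar (color_family I)"

definition laminar_undirected_input :: "'n::linordered_idom sim_input \<Rightarrow> bool" where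
  "laminar_undirected_input I \<longleftrightarrow> undirected_input I \<and> laminar (color_family I)"

end

(* Call a color class minimal if it contains no color class properly. For a laminar family, minimal
   classes are equal or disjoint, and every class contains one. Since no s-t path contains another,
   a solution of the exact problem meets a class and the minimal classes inside it in the same path.
   So the problem is infeasible if two different minimal classes lie in a common class; otherwise all
   arcs of a solution lie in minimal classes, and independent shortest paths in these are optimal.
   For the superset problem only minimal classes matter. All arcs of negative cost may be bought, and
   shortest paths with respect to max(c, 0) in the minimal classes are optimal.

   Shortest paths are found by a Bellman-Ford algorithm that stores whole paths. Running times are
   bounded through a class of functions on values that contains the basic operations and is closed
   under composition, case distinction and folds with polynomially bounded intermediate results. *)

theory Submission
  imports Defs
begin

section \<open>Polynomial bounds\<close>

text \<open>A fold may double its accumulator in every step, so polynomial-time functions are closed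
  under folds only if the intermediate values are bounded as well. The critical fold is the
  Bellman-Ford loop, which carries sums of costs along: its bound needs a size measure under which
  adding one cost adds, rather than multiplies, bits. Labels carry whole paths, so the answer is
  read off directly and no predecessor pointers have to be followed. Conservative costs allow cycles
  of cost 0; a label is added only if it is strictly cheaper than every label of its vertex, and
  this keeps the stored paths simple.

  All four problems are solved by one function with two flags, \<open>und\<close> and
  \<open>super\<close>. To make this possible, the combinatorial argument sees the s-t paths only as
  a family of nonempty sets none of which contains another, a property proved once for directed arcs
  and doubled undirected edges by a cut that ignores orientation. Functions on encoded values are
  total and have a counterpart on ordinary lists; correctness is proved for the counterpart and
  transferred along the encoding.\<close>

definition is_poly :: "(nat \<Rightarrow> nat) \<Rightarrow> bool" where
  "is_poly g \<longleftrightarrow> (\<exists>p. g = poly p)"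

lemma is_poly_id : "is_poly (\<lambda>n. n)"
  unfolding is_poly_def by (rule exI[of _ "[:0, 1:]"]) auto

lemma is_poly_const : "is_poly (\<lambda>n. a)"
  unfolding is_poly_def by (rule exI[of _ "[:a:]"]) auto

lemma is_poly_add : "is_poly g \<Longrightarrow> is_poly h \<Longrightarrow> is_poly (\<lambda>n. g n + h n)"
  unfolding is_poly_def by (auto simp flip: poly_add)

lemma is_poly_mult : "is_poly g \<Longrightarrow> is_poly h \<Longrightarrow> is_poly (\<lambda>n. g n * h n)"
  unfolding is_poly_def by (auto simp flip: poly_mult)

lemma is_poly_compose: "is_poly g \<Longrightarrow> is_poly h \<Longrightarrow> is_poly (\<lambda>n. g (h n))"
  unfolding is_poly_def by (auto simp flip: poly_pcompose)

lemma is_poly_Suc : "is_poly g \<Longrightarrow> is_poly (\<lambda>n. Suc (g n))"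
  using is_poly_add[OF is_poly_const[of 1]] by simp

text \<open>The coefficients are natural numbers, so every polynomial here is monotone. All
  estimates below rely on replacing a size by an upper bound inside a polynomial.\<close>

lemma is_poly_mono: "is_poly g \<Longrightarrow> m \<le> n \<Longrightarrow> g m \<le> g n"
proof -
  have "m \<le> n \<Longrightarrow> poly p m \<le> poly p n" for p
    by (induction p) (auto intro: add_mono mult_mono)
  then show "is_poly g \<Longrightarrow> m \<le> n \<Longrightarrow> g m \<le> g n" by (auto simp: is_poly_def)
qed

lemmas is_poly_intros = is_poly_id is_poly_const is_poly_Suc is_poly_add is_poly_mult

section \<open>Programs as functions on values\<close>

text \<open>Total on all values: \<open>polyfun\<close> quantifies over arbitrary values, not only
  over encodings. A list may thus end in a number as well as in \<open>Leaf\<close>.\<close>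

fun dec_list :: "'n val \<Rightarrow> 'n val list" where
  "dec_list (Node v w) = v # dec_list w"
| "dec_list _ = []"

lemma enc_list_simps [simp]: "enc_list [] = Leaf" "enc_list (v # vs) = Node v (enc_list vs)"
  by (simp_all add: enc_list_def)

lemma dec_enc_list [simp]: "dec_list (enc_list vs) = vs"
  by (induction vs) auto

text \<open>The measure \<open>mu\<close> is equivalent to \<open>sz\<close> up to a factor of 2, but in contrast to \<open>bit_size\<close>
  it is subadditive up to a constant, so that long sums remain of polynomial size.\<close>

locale cost_model =
  fixes sz mu :: "'n::linordered_idom \<Rightarrow> nat" and K :: nat
  assumes mu_le: "mu q \<le> sz q" and le_mu: "sz q \<le> 2 * mu q"
    and mu_add: "mu (x + y) \<le> mu x + mu y + K"
begin

abbreviation vsize :: "'n val \<Rightarrow> nat" where "vsize \<equiv> val_size mu"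

lemma vsize_pos [simp]: "0 < vsize v" "Suc 0 \<le> vsize v" "vsize v \<noteq> 0"
  by (cases v; simp)+

lemma vsize_le: "vsize v \<le> val_size sz v"
  by (induction v) (auto simp: mu_le intro: add_mono)

lemma le_vsize: "val_size sz v \<le> 2 * vsize v"
  by (induction v) (use le_mu in \<open>auto simp: le_SucI\<close>)

lemma vsize_left: "vsize (left v) \<le> vsize v"
  by (cases v) auto

lemma vsize_right: "vsize (right v) \<le> vsize v"
  by (cases v) auto

text \<open>On \<open>Leaf\<close> both projections are \<open>Leaf\<close> of size 1, which is why
  \<open>Suc\<close> appears.\<close>

lemma vsize_left_right: "vsize (left v) + vsize (right v) \<le> Suc (vsize v)"
  by (cases v) auto

lemma vsize_truth: "vsize (truth b) \<le> 3"
  by (auto simp: truth_def)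

lemma vsize_mem: "e \<in> set vs \<Longrightarrow> vsize e \<le> vsize (enc_list vs)"
  by (induction vs) auto

lemma vsize_enc_append: "vsize (enc_list (vs @ ws)) + 1 = vsize (enc_list vs) + vsize (enc_list ws)"
  by (induction vs) auto

lemma vsize_enc_dec: "vsize (enc_list (dec_list v)) \<le> vsize v"
  by (induction v) auto

lemma vsize_enc_rev: "vsize (enc_list (rev vs)) = vsize (enc_list vs)"
proof (induction vs)
  case (Cons v vs)
  then show ?case using vsize_enc_append[of "rev vs" "[v]"] by simp
qed simp

lemma length_le_vsize: "length vs \<le> vsize (enc_list vs)"
  by (induction vs) auto

lemma vsize_enc_take: "vsize (enc_list (take k vs)) \<le> vsize (enc_list vs)"
  by (induction vs arbitrary: k) (auto simp: take_Cons split: nat.splits)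

text \<open>Variable \<open>b\<close> serves as input and output, smaller variables are preserved, and larger ones are
  scratch space with arbitrary contents.\<close>

definition computes :: "nat \<Rightarrow> com \<Rightarrow> ('n val \<Rightarrow> 'n val) \<Rightarrow> (nat \<Rightarrow> nat) \<Rightarrow> bool" where
  "computes b c f g \<longleftrightarrow> (\<forall>\<sigma>. \<exists>n \<tau>. exec sz c \<sigma> n \<tau> \<and> \<tau> b = f (\<sigma> b) \<and> (\<forall>x<b. \<tau> x = \<sigma> x) \<and>
     n \<le> g (vsize (\<sigma> b)))"

text \<open>The bound on the result is part of the notion because the time of a composition depends
  on the size of the intermediate value. A program is required for every base \<open>b\<close>, so
  that subprograms can be placed above the variables that have to survive.\<close>

definition polyfun :: "('n val \<Rightarrow> 'n val) \<Rightarrow> bool" where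
  "polyfun f \<longleftrightarrow> (\<exists>g. is_poly g \<and> (\<forall>v. vsize (f v) \<le> g (vsize v))) \<and>
     (\<forall>b. \<exists>c g. is_poly g \<and> computes b c f g)"

lemma polyfunI:
  assumes "is_poly g" and "\<And>v. vsize (f v) \<le> g (vsize v)"
    and "\<And>b. \<exists>c h. is_poly h \<and> (\<forall>\<sigma>. \<exists>n \<tau>. exec sz c \<sigma> n \<tau> \<and> \<tau> b = f (\<sigma> b) \<and>
       (\<forall>x<b. \<tau> x = \<sigma> x) \<and> n \<le> h (vsize (\<sigma> b)))"
  shows "polyfun f"
  unfolding polyfun_def computes_def using assms by blast

lemma polyfun_size: "polyfun f \<Longrightarrow> \<exists>g. is_poly g \<and> (\<forall>v. vsize (f v) \<le> g (vsize v))"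
  unfolding polyfun_def by (rule conjunct1)

lemma polyfun_time:
  "polyfun f \<Longrightarrow> \<exists>c g. is_poly g \<and> (\<forall>\<sigma>. \<exists>n \<tau>. exec sz c \<sigma> n \<tau> \<and> \<tau> b = f (\<sigma> b) \<and>
     (\<forall>x<b. \<tau> x = \<sigma> x) \<and> n \<le> g (vsize (\<sigma> b)))"
  unfolding polyfun_def computes_def by (drule conjunct2) (rule spec)

text \<open>Calling convention for subprograms: the argument is evaluated into variable
  \<open>i\<close>, and the program based at \<open>i\<close> leaves all smaller variables alone.
  Choosing \<open>i\<close> above \<open>b\<close> preserves the caller's input.\<close>

lemma polyfun_call:
  assumes "polyfun f"
  shows "\<exists>c g. is_poly g \<and> (\<forall>\<sigma>. \<exists>n \<tau>. exec sz c \<sigma> n \<tau> \<and> \<tau> i = f (eval_expr e \<sigma>) \<and>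
     (\<forall>x<i. \<tau> x = \<sigma> x) \<and> n \<le> expr_time sz e \<sigma> + g (vsize (eval_expr e \<sigma>)))"
proof -
  obtain c g where g: "is_poly g" and c: "\<And>\<sigma>. \<exists>n \<tau>. exec sz c \<sigma> n \<tau> \<and> \<tau> i = f (\<sigma> i) \<and>
     (\<forall>x<i. \<tau> x = \<sigma> x) \<and> n \<le> g (vsize (\<sigma> i))"
    using polyfun_time[OF assms, of i] by blast
  have "\<exists>n \<tau>. exec sz (SeqC (AssignC i e) c) \<sigma> n \<tau> \<and> \<tau> i = f (eval_expr e \<sigma>) \<and>
     (\<forall>x<i. \<tau> x = \<sigma> x) \<and> n \<le> expr_time sz e \<sigma> + Suc (g (vsize (eval_expr e \<sigma>)))" for \<sigma>
  proof -
    obtain n \<tau> where n: "exec sz c (\<sigma>(i := eval_expr e \<sigma>)) n \<tau>" "\<tau> i = f (eval_expr e \<sigma>)"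
       "\<forall>x<i. \<tau> x = (\<sigma>(i := eval_expr e \<sigma>)) x" "n \<le> g (vsize (eval_expr e \<sigma>))"
      using c[of "\<sigma>(i := eval_expr e \<sigma>)"] by auto
    from exec.seq[OF exec.assign n(1)] n(2-) show ?thesis by fastforce
  qed
  then show ?thesis using is_poly_Suc[OF g] by blast
qed

section \<open>Closure under composition, basic operations and case distinction\<close>

lemma polyfun_id: "polyfun (\<lambda>v. v)"
  by (rule polyfunI[where g = "\<lambda>n. n"])
    (auto intro!: exI[of _ SkipC] exI[of _ "\<lambda>_. 1"] exec.skip is_poly_intros)

lemma polyfun_compose:
  assumes "polyfun f" and "polyfun g"
  shows "polyfun (\<lambda>v. f (g v))"
proof -
  obtain gf where gf: "is_poly gf" "\<And>v. vsize (f v) \<le> gf (vsize v)" using polyfun_size[OF assms(1)] by blast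
  obtain gg where gg: "is_poly gg" "\<And>v. vsize (g v) \<le> gg (vsize v)" using polyfun_size[OF assms(2)] by blast
  show ?thesis
  proof (rule polyfunI)
    show "is_poly (\<lambda>n. gf (gg n))" by (rule is_poly_compose[OF gf(1) gg(1)])
    show "vsize (f (g v)) \<le> gf (gg (vsize v))" for v
      using gf(2)[of "g v"] is_poly_mono[OF gf(1) gg(2)] order.trans by blast
    fix b
    obtain c h where h: "is_poly h" and c: "\<And>\<sigma>. \<exists>n \<tau>. exec sz c \<sigma> n \<tau> \<and> \<tau> b = f (\<sigma> b) \<and>
     (\<forall>x<b. \<tau> x = \<sigma> x) \<and> n \<le> h (vsize (\<sigma> b))" using polyfun_time[OF assms(1), of b] by blast
    obtain d k where k: "is_poly k" and d: "\<And>\<sigma>. \<exists>n \<tau>. exec sz d \<sigma> n \<tau> \<and> \<tau> b = g (\<sigma> b) \<and>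
     (\<forall>x<b. \<tau> x = \<sigma> x) \<and> n \<le> k (vsize (\<sigma> b))" using polyfun_time[OF assms(2), of b] by blast
    show "\<exists>c h. is_poly h \<and> (\<forall>\<sigma>. \<exists>n \<tau>. exec sz c \<sigma> n \<tau> \<and> \<tau> b = f (g (\<sigma> b)) \<and>
       (\<forall>x<b. \<tau> x = \<sigma> x) \<and> n \<le> h (vsize (\<sigma> b)))"
    proof (intro exI[of _ "SeqC d c"] exI[of _ "\<lambda>n. k n + h (gg n)"] conjI allI)
      show "is_poly (\<lambda>n. k n + h (gg n))" by (intro is_poly_intros k is_poly_compose[OF h gg(1)])
      fix \<sigma>
      obtain n1 \<tau>1 where 1: "exec sz d \<sigma> n1 \<tau>1" "\<tau>1 b = g (\<sigma> b)" "\<forall>x<b. \<tau>1 x = \<sigma> x"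
         "n1 \<le> k (vsize (\<sigma> b))" using d by blast
      obtain n2 \<tau>2 where 2: "exec sz c \<tau>1 n2 \<tau>2" "\<tau>2 b = f (\<tau>1 b)" "\<forall>x<b. \<tau>2 x = \<tau>1 x"
         "n2 \<le> h (vsize (\<tau>1 b))" using c by blast
      have "n2 \<le> h (gg (vsize (\<sigma> b)))"
        using 2(4) 1(2) is_poly_mono[OF h gg(2)] order.trans by metis
      then show "\<exists>n \<tau>. exec sz (SeqC d c) \<sigma> n \<tau> \<and> \<tau> b = f (g (\<sigma> b)) \<and>
       (\<forall>x<b. \<tau> x = \<sigma> x) \<and> n \<le> k (vsize (\<sigma> b)) + h (gg (vsize (\<sigma> b)))"
        using exec.seq[OF 1(1) 2(1)] 1 2 by (metis add_mono)
    qed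
  qed
qed

lemma polyfun_unary:
  assumes E: "\<And>x \<sigma>. eval_expr (E (Var x)) \<sigma> = F (\<sigma> x)"
    and sub: "\<And>x. subexprs (E (Var x)) = [E (Var x), Var x]"
    and size: "\<And>v. vsize (F v) \<le> vsize v + C"
  shows "polyfun F"
proof (rule polyfunI)
  show "is_poly (\<lambda>n. n + C)" by (intro is_poly_intros)
  show "vsize (F v) \<le> vsize v + C" for v by (rule size)
  fix b
  \<comment> \<open>Two subexpressions are evaluated, and each value costs at most twice its
    \<open>vsize\<close>, which is at most \<open>vsize (\<sigma> b) + C\<close>.\<close>
  have time: "expr_time sz (E (Var b)) \<sigma> \<le> 4 * (vsize (\<sigma> b) + C)" for \<sigma>
    using le_vsize[of "\<sigma> b"] le_vsize[of "F (\<sigma> b)"] size[of "\<sigma> b"]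
    by (simp add: expr_time_def sub E)
  show "\<exists>c h. is_poly h \<and> (\<forall>\<sigma>. \<exists>n \<tau>. exec sz c \<sigma> n \<tau> \<and> \<tau> b = F (\<sigma> b) \<and>
       (\<forall>x<b. \<tau> x = \<sigma> x) \<and> n \<le> h (vsize (\<sigma> b)))"
  proof (intro exI[of _ "AssignC b (E (Var b))"] exI[of _ "\<lambda>n. 1 + 4 * (n + C)"] conjI allI)
    show "is_poly (\<lambda>n. 1 + 4 * (n + C))" by (intro is_poly_intros)
    show "\<exists>n \<tau>. exec sz (AssignC b (E (Var b))) \<sigma> n \<tau> \<and> \<tau> b = F (\<sigma> b) \<and>
       (\<forall>x<b. \<tau> x = \<sigma> x) \<and> n \<le> 1 + 4 * (vsize (\<sigma> b) + C)" for \<sigma>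
      using exec.assign[of sz b "E (Var b)" \<sigma>] time[of \<sigma>] by (fastforce simp: E)
  qed
qed

lemma polyfun_left0: "polyfun left"
  by (rule polyfun_unary[where E = HdE and C = 0]) (auto simp: vsize_left)

lemma polyfun_right0: "polyfun right"
  by (rule polyfun_unary[where E = TlE and C = 0]) (auto simp: vsize_right)

lemma polyfun_const:
  assumes "\<And>\<sigma>. eval_expr e \<sigma> = a" and "subexprs e = [e]"
  shows "polyfun (\<lambda>v. a)"
proof (rule polyfunI)
  show "is_poly (\<lambda>n. vsize a)" by (rule is_poly_const)
  show "\<exists>c h. is_poly h \<and> (\<forall>\<sigma>. \<exists>n \<tau>. exec sz c \<sigma> n \<tau> \<and> \<tau> b = a \<and>
       (\<forall>x<b. \<tau> x = \<sigma> x) \<and> n \<le> h (vsize (\<sigma> b)))" for b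
  proof (intro exI[of _ "AssignC b e"] exI[of _ "\<lambda>n. 1 + val_size sz a"] conjI allI)
    show "\<exists>n \<tau>. exec sz (AssignC b e) \<sigma> n \<tau> \<and> \<tau> b = a \<and>
       (\<forall>x<b. \<tau> x = \<sigma> x) \<and> n \<le> 1 + val_size sz a" for \<sigma>
      using exec.assign[of sz b e \<sigma>] by (fastforce simp: assms expr_time_def)
  qed (rule is_poly_const)
qed auto

lemma polyfun_Leaf: "polyfun (\<lambda>v. Leaf)"
  by (rule polyfun_const[of NilE]) auto

lemma polyfun_zero: "polyfun (\<lambda>v. Num 0)"
  by (rule polyfun_const[of ZeroE]) auto

lemma polyfun_binary:
  assumes E: "\<And>x y \<sigma>. eval_expr (E (Var x) (Var y)) \<sigma> = F (\<sigma> x) (\<sigma> y)"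
    and sub: "\<And>x y. subexprs (E (Var x) (Var y)) = [E (Var x) (Var y), Var x, Var y]"
    and size: "\<And>v w. vsize (F v w) \<le> vsize v + vsize w + C"
    and f: "polyfun f" and g: "polyfun g"
  shows "polyfun (\<lambda>v. F (f v) (g v))"
proof -
  obtain gf where gf: "is_poly gf" "\<And>v. vsize (f v) \<le> gf (vsize v)" using polyfun_size[OF f] by blast
  obtain gg where gg: "is_poly gg" "\<And>v. vsize (g v) \<le> gg (vsize v)" using polyfun_size[OF g] by blast
  show ?thesis
  proof (rule polyfunI)
    show "is_poly (\<lambda>n. gf n + gg n + C)" by (intro is_poly_intros gf gg)
    show "vsize (F (f v) (g v)) \<le> gf (vsize v) + gg (vsize v) + C" for v
      using size[of "f v" "g v"] gf(2)[of v] gg(2)[of v] by linarith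
    fix b
    obtain c h where h: "is_poly h" and c: "\<And>\<sigma>. \<exists>n \<tau>. exec sz c \<sigma> n \<tau> \<and>
       \<tau> (b+1) = f (eval_expr (Var b) \<sigma>) \<and> (\<forall>x<b+1. \<tau> x = \<sigma> x) \<and>
       n \<le> expr_time sz (Var b) \<sigma> + h (vsize (eval_expr (Var b) \<sigma>))"
      \<comment> \<open>The first argument goes to \<open>b+1\<close>; the second program is based
        at \<open>b+2\<close> and therefore keeps it, along with the input in
        \<open>b\<close>.\<close>
      using polyfun_call[OF f, of "b+1" "Var b"] by blast
    obtain d k where k: "is_poly k" and d: "\<And>\<sigma>. \<exists>n \<tau>. exec sz d \<sigma> n \<tau> \<and>
       \<tau> (b+2) = g (eval_expr (Var b) \<sigma>) \<and> (\<forall>x<b+2. \<tau> x = \<sigma> x) \<and>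
       n \<le> expr_time sz (Var b) \<sigma> + k (vsize (eval_expr (Var b) \<sigma>))"
      using polyfun_call[OF g, of "b+2" "Var b"] by blast
    define e where "e = E (Var (b+1)) (Var (b+2))"
    let ?c = "SeqC c (SeqC d (AssignC b e))"
    \<comment> \<open>Reading \<open>b\<close> twice costs \<open>4 * n\<close>. The two arguments
      are charged once by themselves and once through the size of the result, each time with the
      factor 2 between \<open>val_size sz\<close> and \<open>vsize\<close>.\<close>
    define H where "H n = 4 * n + h n + k n + 4 * gf n + 4 * gg n + 2 * C + 1" for n
    show "\<exists>c h. is_poly h \<and> (\<forall>\<sigma>. \<exists>n \<tau>. exec sz c \<sigma> n \<tau> \<and> \<tau> b = F (f (\<sigma> b)) (g (\<sigma> b)) \<and>
       (\<forall>x<b. \<tau> x = \<sigma> x) \<and> n \<le> h (vsize (\<sigma> b)))"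
    proof (intro exI[of _ ?c] exI[of _ H] conjI allI)
      show "is_poly H" unfolding H_def by (intro is_poly_intros h k gf(1) gg(1))
      fix \<sigma>
      obtain n1 \<tau>1 where 1: "exec sz c \<sigma> n1 \<tau>1" "\<tau>1 (b+1) = f (\<sigma> b)" "\<forall>x<b+1. \<tau>1 x = \<sigma> x"
         "n1 \<le> expr_time sz (Var b) \<sigma> + h (vsize (\<sigma> b))" using c[of \<sigma>] by auto
      obtain n2 \<tau>2 where 2: "exec sz d \<tau>1 n2 \<tau>2" "\<tau>2 (b+2) = g (\<tau>1 b)" "\<forall>x<b+2. \<tau>2 x = \<tau>1 x"
         "n2 \<le> expr_time sz (Var b) \<tau>1 + k (vsize (\<tau>1 b))" using d[of \<tau>1] by auto
      have b: "\<tau>1 b = \<sigma> b" using 1(3) by simp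
      have \<tau>2: "\<tau>2 (b+1) = f (\<sigma> b)" "\<tau>2 (b+2) = g (\<sigma> b)" using 1 2 b by simp_all
      have e: "eval_expr e \<tau>2 = F (f (\<sigma> b)) (g (\<sigma> b))" using \<tau>2 by (simp add: e_def E)
      have "expr_time sz e \<tau>2 \<le> 4 * gf (vsize (\<sigma> b)) + 4 * gg (vsize (\<sigma> b)) + 2 * C"
        using \<tau>2 e le_vsize[of "F (f (\<sigma> b)) (g (\<sigma> b))"] size[of "f (\<sigma> b)" "g (\<sigma> b)"]
          le_vsize[of "f (\<sigma> b)"] le_vsize[of "g (\<sigma> b)"] gf(2)[of "\<sigma> b"] gg(2)[of "\<sigma> b"]
        by (simp add: expr_time_def e_def sub E)
      moreover have "n1 \<le> 2 * vsize (\<sigma> b) + h (vsize (\<sigma> b))" "n2 \<le> 2 * vsize (\<sigma> b) + k (vsize (\<sigma> b))"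
        using 1(4) 2(4) b le_vsize[of "\<sigma> b"] by (simp_all add: expr_time_def)
      ultimately have "n1 + (n2 + (1 + expr_time sz e \<tau>2)) \<le> H (vsize (\<sigma> b))"
        unfolding H_def by linarith
      moreover have "exec sz ?c \<sigma> (n1 + (n2 + (1 + expr_time sz e \<tau>2))) (\<tau>2(b := eval_expr e \<tau>2))"
        by (intro exec.seq[OF 1(1)] exec.seq[OF 2(1)] exec.assign)
      ultimately show "\<exists>n \<tau>. exec sz ?c \<sigma> n \<tau> \<and> \<tau> b = F (f (\<sigma> b)) (g (\<sigma> b)) \<and>
       (\<forall>x<b. \<tau> x = \<sigma> x) \<and> n \<le> H (vsize (\<sigma> b))"
        using e 1(3) 2(3) by (intro exI conjI) (assumption | simp)+
    qed
  qed
qed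

lemma polyfun_Node: "polyfun f \<Longrightarrow> polyfun g \<Longrightarrow> polyfun (\<lambda>v. Node (f v) (g v))"
  by (rule polyfun_binary[where E = ConsE and C = 1]) auto

abbreviation vadd :: "'n val \<Rightarrow> 'n val \<Rightarrow> 'n val" where
  "vadd \<equiv> num_op (\<lambda>x y. Num (x + y))"

definition vless :: "'n val \<Rightarrow> 'n val \<Rightarrow> bool" where
  "vless v w \<longleftrightarrow> num_op (\<lambda>x y. truth (x < y)) v w \<noteq> Leaf"

lemma vless_Num [simp]: "vless (Num x) (Num y) \<longleftrightarrow> x < y"
  by (simp add: vless_def truth_def)

lemma vsize_vadd: "vsize (vadd v w) \<le> vsize v + vsize w + K"
  by (cases v; cases w) (auto intro: mu_add order.trans simp: le_SucI)

lemma polyfun_vadd: "polyfun f \<Longrightarrow> polyfun g \<Longrightarrow> polyfun (\<lambda>v. vadd (f v) (g v))"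
  by (rule polyfun_binary[where E = AddE and C = K]) (auto simp: vsize_vadd)

lemma vsize_less: "vsize (num_op (\<lambda>x y. truth (x < y)) v w) \<le> vsize v + vsize w + 3"
  by (cases v; cases w) (auto simp: truth_def)

lemma polyfun_less0:
  "polyfun f \<Longrightarrow> polyfun g \<Longrightarrow> polyfun (\<lambda>v. num_op (\<lambda>x y. truth (x < y)) (f v) (g v))"
  by (rule polyfun_binary[where E = LessE and C = 3]) (auto intro: vsize_less)

lemma polyfun_eq0: "polyfun f \<Longrightarrow> polyfun g \<Longrightarrow> polyfun (\<lambda>v. truth (f v = g v))"
  by (rule polyfun_binary[where E = EqE and C = 3]) (auto simp: vsize_truth trans_le_add2)

lemma polyfun_if0:
  assumes t: "polyfun t" and f: "polyfun f" and g: "polyfun g"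
  shows "polyfun (\<lambda>v. if t v \<noteq> Leaf then f v else g v)"
proof -
  obtain gf where gf: "is_poly gf" "\<And>v. vsize (f v) \<le> gf (vsize v)" using polyfun_size[OF f] by blast
  obtain gg where gg: "is_poly gg" "\<And>v. vsize (g v) \<le> gg (vsize v)" using polyfun_size[OF g] by blast
  obtain gt where gt: "is_poly gt" "\<And>v. vsize (t v) \<le> gt (vsize v)" using polyfun_size[OF t] by blast
  show ?thesis
  proof (rule polyfunI)
    show "is_poly (\<lambda>n. gf n + gg n)" by (intro is_poly_intros gf gg)
    show "vsize (if t v \<noteq> Leaf then f v else g v) \<le> gf (vsize v) + gg (vsize v)" for v
      using gf(2)[of v] gg(2)[of v] by simp
    fix b
    obtain ct ht where ht: "is_poly ht" and ct: "\<And>\<sigma>. \<exists>n \<tau>. exec sz ct \<sigma> n \<tau> \<and>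
       \<tau> (b+1) = t (eval_expr (Var b) \<sigma>) \<and> (\<forall>x<b+1. \<tau> x = \<sigma> x) \<and>
       n \<le> expr_time sz (Var b) \<sigma> + ht (vsize (eval_expr (Var b) \<sigma>))"
      using polyfun_call[OF t, of "b+1" "Var b"] by blast
    obtain c h where h: "is_poly h" and c: "\<And>\<sigma>. \<exists>n \<tau>. exec sz c \<sigma> n \<tau> \<and> \<tau> b = f (\<sigma> b) \<and>
     (\<forall>x<b. \<tau> x = \<sigma> x) \<and> n \<le> h (vsize (\<sigma> b))" using polyfun_time[OF f, of b] by blast
    obtain d k where k: "is_poly k" and d: "\<And>\<sigma>. \<exists>n \<tau>. exec sz d \<sigma> n \<tau> \<and> \<tau> b = g (\<sigma> b) \<and>
     (\<forall>x<b. \<tau> x = \<sigma> x) \<and> n \<le> k (vsize (\<sigma> b))" using polyfun_time[OF g, of b] by blast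
    let ?c = "SeqC ct (IfC (Var (b+1)) c d)"
    define H where "H n = 2 * n + ht n + 2 * gt n + h n + k n + 1" for n
    show "\<exists>c h. is_poly h \<and> (\<forall>\<sigma>. \<exists>n \<tau>. exec sz c \<sigma> n \<tau> \<and>
       \<tau> b = (if t (\<sigma> b) \<noteq> Leaf then f (\<sigma> b) else g (\<sigma> b)) \<and>
       (\<forall>x<b. \<tau> x = \<sigma> x) \<and> n \<le> h (vsize (\<sigma> b)))"
    proof (intro exI[of _ ?c] exI[of _ H] conjI allI)
      show "is_poly H" unfolding H_def by (intro is_poly_intros ht h k gt(1))
      fix \<sigma>
      obtain n1 \<tau>1 where 1: "exec sz ct \<sigma> n1 \<tau>1" "\<tau>1 (b+1) = t (\<sigma> b)" "\<forall>x<b+1. \<tau>1 x = \<sigma> x"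
         "n1 \<le> expr_time sz (Var b) \<sigma> + ht (vsize (\<sigma> b))" using ct[of \<sigma>] by auto
      have b: "\<tau>1 b = \<sigma> b" using 1(3) by simp
      obtain n2 \<tau>2 where 2: "exec sz c \<tau>1 n2 \<tau>2" "\<tau>2 b = f (\<sigma> b)" "\<forall>x<b. \<tau>2 x = \<tau>1 x"
         "n2 \<le> h (vsize (\<sigma> b))" using c[of \<tau>1] b by auto
      obtain n3 \<tau>3 where 3: "exec sz d \<tau>1 n3 \<tau>3" "\<tau>3 b = g (\<sigma> b)" "\<forall>x<b. \<tau>3 x = \<tau>1 x"
         "n3 \<le> k (vsize (\<sigma> b))" using d[of \<tau>1] b by auto
      have n1: "n1 \<le> 2 * vsize (\<sigma> b) + ht (vsize (\<sigma> b))"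
        using 1(4) le_vsize[of "\<sigma> b"] by (simp add: expr_time_def)
      have e: "expr_time sz (Var (b+1)) \<tau>1 \<le> 2 * gt (vsize (\<sigma> b))"
        using 1(2) le_vsize[of "t (\<sigma> b)"] gt(2)[of "\<sigma> b"] by (simp add: expr_time_def)
      show "\<exists>n \<tau>. exec sz ?c \<sigma> n \<tau> \<and> \<tau> b = (if t (\<sigma> b) \<noteq> Leaf then f (\<sigma> b) else g (\<sigma> b)) \<and>
       (\<forall>x<b. \<tau> x = \<sigma> x) \<and> n \<le> H (vsize (\<sigma> b))"
      proof (cases "t (\<sigma> b) = Leaf")
        case False
        then have "exec sz ?c \<sigma> (n1 + (1 + expr_time sz (Var (b+1)) \<tau>1 + n2)) \<tau>2"
          using 1(2) by (intro exec.seq[OF 1(1)] exec.if_true 2(1)) simp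
        moreover have "n1 + (1 + expr_time sz (Var (b+1)) \<tau>1 + n2) \<le> H (vsize (\<sigma> b))"
          using n1 e 2(4) unfolding H_def by linarith
        ultimately show ?thesis using False 1(3) 2(2,3)
          by (intro exI conjI) (assumption | simp)+
      next
        case True
        then have "exec sz ?c \<sigma> (n1 + (1 + expr_time sz (Var (b+1)) \<tau>1 + n3)) \<tau>3"
          using 1(2) by (intro exec.seq[OF 1(1)] exec.if_false 3(1)) simp
        moreover have "n1 + (1 + expr_time sz (Var (b+1)) \<tau>1 + n3) \<le> H (vsize (\<sigma> b))"
          using n1 e 3(4) unfolding H_def by linarith
        ultimately show ?thesis using True 1(3) 3(2,3)
          by (intro exI conjI) (assumption | simp)+
      qed
    qed
  qed
qed

text \<open>Variable \<open>b\<close> holds the environment, \<open>b+1\<close> the remaining list,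
  \<open>b+2\<close> the accumulator, and \<open>b+3\<close> receives the result of the body.
  Bounding the accumulator on all prefixes is a condition that passes from a list to its tail. Each
  iteration pays for the test, the body, copying the accumulator and taking the tail;
  \<open>Suc\<close> accounts for the final failing test.\<close>

lemma loop_foldl:
  assumes d: "\<And>\<sigma>. \<exists>n \<tau>. exec sz d \<sigma> n \<tau> \<and>
      \<tau> (b+3) = step (\<sigma> b) (\<sigma> (b+2)) (left (\<sigma> (b+1))) \<and> (\<forall>x<b+3. \<tau> x = \<sigma> x) \<and>
      n \<le> G (vsize (\<sigma> b) + vsize (\<sigma> (b+1)) + vsize (\<sigma> (b+2)))"
    and G: "is_poly G"
    and "\<And>k. vsize (foldl (step (\<sigma> b)) (\<sigma> (b+2)) (take k (dec_list (\<sigma> (b+1))))) \<le> A"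
    and "vsize (\<sigma> (b+1)) \<le> L"
  shows "\<exists>n \<tau>. exec sz (WhileC (IsNodeE (Var (b+1)))
        (SeqC d (SeqC (AssignC (b+2) (Var (b+3))) (AssignC (b+1) (TlE (Var (b+1))))))) \<sigma> n \<tau> \<and>
      \<tau> (b+2) = foldl (step (\<sigma> b)) (\<sigma> (b+2)) (dec_list (\<sigma> (b+1))) \<and> (\<forall>x\<le>b. \<tau> x = \<sigma> x) \<and>
      n \<le> Suc (length (dec_list (\<sigma> (b+1)))) * (G (vsize (\<sigma> b) + L + A) + 2 * A + 6 * L + 9)"
    (is "\<exists>n \<tau>. exec sz (WhileC ?t ?body) \<sigma> n \<tau> \<and> ?post n \<tau> \<sigma>")
  using assms(3,4)
\<comment> \<open>The state is generalized because an iteration changes the list, the accumulator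
  and the scratch variables.\<close>
proof (induction "\<sigma> (b+1)" arbitrary: \<sigma> rule: dec_list.induct)
  case (1 v w \<sigma>)
  note \<sigma> = 1(2)[symmetric]
  let ?W = "G (vsize (\<sigma> b) + L + A) + 2 * A + 6 * L + 9"
  have A: "vsize (\<sigma> (b+2)) \<le> A" using 1(3)[of 0] by simp
  obtain n \<tau> where n: "exec sz d \<sigma> n \<tau>" "\<tau> (b+3) = step (\<sigma> b) (\<sigma> (b+2)) v" "\<forall>x<b+3. \<tau> x = \<sigma> x"
      "n \<le> G (vsize (\<sigma> b) + vsize (\<sigma> (b+1)) + vsize (\<sigma> (b+2)))"
    using d[of \<sigma>] \<sigma> by auto
  define \<tau>1 where "\<tau>1 = \<tau>(b+2 := \<tau> (b+3))"
  define \<tau>2 where "\<tau>2 = \<tau>1(b+1 := right (\<tau>1 (b+1)))"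
  have \<tau>2: "\<tau>2 (b+1) = w" "\<tau>2 (b+2) = step (\<sigma> b) (\<sigma> (b+2)) v" "\<forall>x\<le>b. \<tau>2 x = \<sigma> x"
    using n(2,3) \<sigma> by (auto simp: \<tau>1_def \<tau>2_def)
  have b: "exec sz ?body \<sigma> (n + ((1 + expr_time sz (Var (b+3)) \<tau>) + (1 + expr_time sz (TlE (Var (b+1))) \<tau>1))) \<tau>2"
    unfolding \<tau>2_def \<tau>1_def
    using exec.assign[of sz "b+2" "Var (b+3)" \<tau>]
      exec.assign[of sz "b+1" "TlE (Var (b+1))" "\<tau>(b+2 := \<tau> (b+3))"]
    by (intro exec.seq[OF n(1)] exec.seq) simp_all
  have "vsize (\<tau>2 (b+1)) \<le> L" using 1(4) \<sigma> \<tau>2(1) by simp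
  moreover have "vsize (foldl (step (\<tau>2 b)) (\<tau>2 (b+2)) (take k (dec_list (\<tau>2 (b+1))))) \<le> A" for k
    using 1(3)[of "Suc k"] \<tau>2 \<sigma> by simp
  ultimately obtain m \<rho> where m: "exec sz (WhileC ?t ?body) \<tau>2 m \<rho>" and post: "?post m \<rho> \<tau>2"
    using 1(1)[of \<tau>2] \<tau>2(1) by blast
  have tt: "eval_expr ?t \<sigma> \<noteq> Leaf" using \<sigma> by (simp add: truth_def)
  have A3: "vsize (\<tau> (b+3)) \<le> A" using 1(3)[of 1] \<sigma> n(2) by (simp add: take_Suc)
  have t1: "expr_time sz ?t \<sigma> \<le> 3 + 2 * L"
    using le_vsize[of "\<sigma> (b+1)"] 1(4) \<sigma> by (simp add: expr_time_def truth_def)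
  have t2: "expr_time sz (Var (b+3)) \<tau> \<le> 2 * A"
    using le_vsize[of "\<tau> (b+3)"] A3 by (simp add: expr_time_def)
  have "\<tau>1 (b+1) = \<sigma> (b+1)" using n(3) by (simp add: \<tau>1_def)
  then have t3: "expr_time sz (TlE (Var (b+1))) \<tau>1 \<le> 4 * L"
    using le_vsize[of "\<sigma> (b+1)"] 1(4) \<sigma> by (simp add: expr_time_def)
  have t4: "n \<le> G (vsize (\<sigma> b) + L + A)"
    using n(4) 1(4) A by (meson G add_mono is_poly_mono le_refl order.trans)
  have "1 + expr_time sz ?t \<sigma> + (n + ((1 + expr_time sz (Var (b+3)) \<tau>) + (1 + expr_time sz (TlE (Var (b+1))) \<tau>1))) \<le> ?W"
    using t1 t2 t3 t4 by linarith
  moreover have "m \<le> Suc (length (dec_list w)) * ?W" using post \<tau>2 by simp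
  ultimately have "1 + expr_time sz ?t \<sigma> + (n + ((1 + expr_time sz (Var (b+3)) \<tau>) + (1 + expr_time sz (TlE (Var (b+1))) \<tau>1))) + m
      \<le> Suc (length (dec_list (\<sigma> (b+1)))) * ?W"
    using \<sigma> by simp
  then show ?case
    using exec.while_true[OF tt b m] post \<tau>2 \<sigma> by (intro exI conjI) (assumption | simp)+
next
  case ("2_1" \<sigma>)
  note \<sigma> = "2_1"(1)[symmetric]
  have "eval_expr ?t \<sigma> = Leaf" using \<sigma> by (simp add: truth_def)
  from exec.while_false[OF this] show ?case
    using \<sigma> by (intro exI conjI) (assumption | simp add: truth_def expr_time_def)+
next
  case ("2_2" q \<sigma>)
  note \<sigma> = "2_2"(1)[symmetric]
  have "expr_time sz ?t \<sigma> \<le> 3 + 2 * L"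
    using le_vsize[of "\<sigma> (b+1)"] "2_2"(3) \<sigma> by (simp add: expr_time_def truth_def)
  moreover have "eval_expr ?t \<sigma> = Leaf" using \<sigma> by (simp add: truth_def)
  from exec.while_false[OF this] calculation show ?case
    using \<sigma> by (intro exI conjI) (assumption | simp)+
qed

text \<open>The three arguments of \<open>step\<close> are packed into one value, environment first,
  then accumulator and element; the environment plays the role of a closure. The bound
  \<open>B\<close> excludes exponential growth, and as it is assumed for every list it applies to
  all prefixes met during the loop.\<close>

lemma polyfun_foldl0:
  assumes step: "polyfun (\<lambda>y. step (left y) (left (right y)) (right (right y)))"
    and init: "polyfun init" and lst: "polyfun lst"
    and B: "is_poly B" "\<And>x vs. vsize (foldl (step x) (init x) vs) \<le> B (vsize x + vsize (enc_list vs))"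
  shows "polyfun (\<lambda>x. foldl (step x) (init x) (dec_list (lst x)))"
proof -
  obtain gl where gl: "is_poly gl" "\<And>v. vsize (lst v) \<le> gl (vsize v)" using polyfun_size[OF lst] by blast
  define BB where "BB n = B (n + gl n)" for n
  have BB: "is_poly BB" unfolding BB_def by (intro is_poly_compose[OF B(1)] is_poly_intros gl(1))
  have take: "vsize (foldl (step x) (init x) (take k (dec_list (lst x)))) \<le> BB (vsize x)" for x k
  proof -
    have "vsize (enc_list (take k (dec_list (lst x)))) \<le> gl (vsize x)"
      using vsize_enc_take vsize_enc_dec gl(2) order.trans by meson
    then show ?thesis unfolding BB_def
      using B(2)[of x] is_poly_mono[OF B(1)] by (meson add_left_mono order.trans)
  qed
  show ?thesis
  proof (rule polyfunI[OF BB])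
    show "vsize (foldl (step x) (init x) (dec_list (lst x))) \<le> BB (vsize x)" for x
      using take[of x "length (dec_list (lst x))"] by simp
    fix b
    obtain cl hl where hl: "is_poly hl" and cl: "\<And>\<sigma>. \<exists>n \<tau>. exec sz cl \<sigma> n \<tau> \<and>
       \<tau> (b+1) = lst (eval_expr (Var b) \<sigma>) \<and> (\<forall>x<b+1. \<tau> x = \<sigma> x) \<and>
       n \<le> expr_time sz (Var b) \<sigma> + hl (vsize (eval_expr (Var b) \<sigma>))"
      using polyfun_call[OF lst, of "b+1" "Var b"] by blast
    obtain ci hi where hi: "is_poly hi" and ci: "\<And>\<sigma>. \<exists>n \<tau>. exec sz ci \<sigma> n \<tau> \<and>
       \<tau> (b+2) = init (eval_expr (Var b) \<sigma>) \<and> (\<forall>x<b+2. \<tau> x = \<sigma> x) \<and>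
       n \<le> expr_time sz (Var b) \<sigma> + hi (vsize (eval_expr (Var b) \<sigma>))"
      using polyfun_call[OF init, of "b+2" "Var b"] by blast
    define e where "e = ConsE (Var b) (ConsE (Var (b+2)) (HdE (Var (b+1))))"
    obtain d hd where hd: "is_poly hd" and d: "\<And>\<sigma>. \<exists>n \<tau>. exec sz d \<sigma> n \<tau> \<and>
       \<tau> (b+3) = (\<lambda>y. step (left y) (left (right y)) (right (right y))) (eval_expr e \<sigma>) \<and>
       (\<forall>x<b+3. \<tau> x = \<sigma> x) \<and> n \<le> expr_time sz e \<sigma> + hd (vsize (eval_expr e \<sigma>))"
      using polyfun_call[OF step, of "b+3" e] by blast
    \<comment> \<open>In the subexpressions of \<open>e\<close> each of the three variables is
      counted at most four times, at a cost of at most twice its \<open>vsize\<close>. The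
      \<open>3\<close> and the \<open>2\<close> stem from the constructors of the argument
      pair.\<close>
    define G where "G n = 8 * n + 3 + hd (n + 2)" for n
    have G: "is_poly G" unfolding G_def
      by (intro is_poly_intros is_poly_compose[OF hd])
    have d': "\<exists>n \<tau>. exec sz d \<sigma> n \<tau> \<and>
      \<tau> (b+3) = step (\<sigma> b) (\<sigma> (b+2)) (left (\<sigma> (b+1))) \<and> (\<forall>x<b+3. \<tau> x = \<sigma> x) \<and>
      n \<le> G (vsize (\<sigma> b) + vsize (\<sigma> (b+1)) + vsize (\<sigma> (b+2)))" for \<sigma>
    proof -
      obtain n \<tau> where n: "exec sz d \<sigma> n \<tau>" "\<tau> (b+3) = step (\<sigma> b) (\<sigma> (b+2)) (left (\<sigma> (b+1)))"
       "\<forall>x<b+3. \<tau> x = \<sigma> x" "n \<le> expr_time sz e \<sigma> + hd (vsize (eval_expr e \<sigma>))"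
        using d[of \<sigma>] by (auto simp: e_def)
      have "val_size sz (left (\<sigma> (b+1))) \<le> val_size sz (\<sigma> (b+1))" by (cases "\<sigma> (b+1)") auto
      then have "expr_time sz e \<sigma> \<le> 8 * (vsize (\<sigma> b) + vsize (\<sigma> (b+1)) + vsize (\<sigma> (b+2))) + 3"
        using le_vsize[of "\<sigma> b"] le_vsize[of "\<sigma> (b+1)"] le_vsize[of "\<sigma> (b+2)"]
        by (simp add: expr_time_def e_def)
      moreover have "hd (vsize (eval_expr e \<sigma>)) \<le> hd (vsize (\<sigma> b) + vsize (\<sigma> (b+1)) + vsize (\<sigma> (b+2)) + 2)"
        using vsize_left[of "\<sigma> (b+1)"] by (intro is_poly_mono[OF hd]) (simp add: e_def)
      ultimately show ?thesis using n unfolding G_def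
        by (intro exI[of _ n] exI[of _ \<tau>] conjI) (assumption | linarith)+
    qed
    let ?loop = "WhileC (IsNodeE (Var (b+1)))
        (SeqC d (SeqC (AssignC (b+2) (Var (b+3))) (AssignC (b+1) (TlE (Var (b+1))))))"
    let ?c = "SeqC cl (SeqC ci (SeqC ?loop (AssignC b (Var (b+2)))))"
    define H where "H n = (2 * n + hl n) + (2 * n + hi n) +
      Suc (gl n) * (G (n + gl n + BB n) + 2 * BB n + 6 * gl n + 9) + (1 + 2 * BB n)" for n
    show "\<exists>c h. is_poly h \<and> (\<forall>\<sigma>. \<exists>n \<tau>. exec sz c \<sigma> n \<tau> \<and>
       \<tau> b = foldl (step (\<sigma> b)) (init (\<sigma> b)) (dec_list (lst (\<sigma> b))) \<and>
       (\<forall>x<b. \<tau> x = \<sigma> x) \<and> n \<le> h (vsize (\<sigma> b)))"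
    proof (intro exI[of _ ?c] exI[of _ H] conjI allI)
      have "is_poly (\<lambda>n. G (n + gl n + BB n))"
        by (intro is_poly_compose[OF G] is_poly_intros gl(1) BB)
      then show "is_poly H" unfolding H_def by (intro is_poly_intros gl(1) BB hl hi)
      fix \<sigma>
      obtain n1 \<tau>1 where 1: "exec sz cl \<sigma> n1 \<tau>1" "\<tau>1 (b+1) = lst (\<sigma> b)" "\<forall>x<b+1. \<tau>1 x = \<sigma> x"
         "n1 \<le> expr_time sz (Var b) \<sigma> + hl (vsize (\<sigma> b))" using cl[of \<sigma>] by auto
      have b: "\<tau>1 b = \<sigma> b" using 1(3) by simp
      obtain n2 \<tau>2 where 2: "exec sz ci \<tau>1 n2 \<tau>2" "\<tau>2 (b+2) = init (\<sigma> b)" "\<forall>x<b+2. \<tau>2 x = \<tau>1 x"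
         "n2 \<le> expr_time sz (Var b) \<tau>1 + hi (vsize (\<sigma> b))" using ci[of \<tau>1] b by auto
      have \<tau>2: "\<tau>2 b = \<sigma> b" "\<tau>2 (b+1) = lst (\<sigma> b)" using 1 2 by auto
      obtain n3 \<tau>3 where 3: "exec sz ?loop \<tau>2 n3 \<tau>3"
        "\<tau>3 (b+2) = foldl (step (\<tau>2 b)) (\<tau>2 (b+2)) (dec_list (\<tau>2 (b+1)))" "\<forall>x\<le>b. \<tau>3 x = \<tau>2 x"
        "n3 \<le> Suc (length (dec_list (\<tau>2 (b+1)))) * (G (vsize (\<tau>2 b) + gl (vsize (\<sigma> b)) + BB (vsize (\<sigma> b)))
           + 2 * BB (vsize (\<sigma> b)) + 6 * gl (vsize (\<sigma> b)) + 9)"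
        using loop_foldl[where d = d and step = step and b = b and G = G and \<sigma> = \<tau>2 and
            A = "BB (vsize (\<sigma> b))" and L = "gl (vsize (\<sigma> b))", OF d' G] take[of "\<sigma> b"] gl(2)[of "\<sigma> b"]
        unfolding \<tau>2 2(2) by blast
      define r where "r = foldl (step (\<sigma> b)) (init (\<sigma> b)) (dec_list (lst (\<sigma> b)))"
      have r: "\<tau>3 (b+2) = r" using 3(2) \<tau>2 2(2) r_def by simp
      have "length (dec_list (lst (\<sigma> b))) \<le> gl (vsize (\<sigma> b))"
        using length_le_vsize[of "dec_list (lst (\<sigma> b))"] vsize_enc_dec[of "lst (\<sigma> b)"] gl(2)[of "\<sigma> b"] by linarith
      then have n3: "n3 \<le> Suc (gl (vsize (\<sigma> b))) * (G (vsize (\<sigma> b) + gl (vsize (\<sigma> b)) + BB (vsize (\<sigma> b)))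
           + 2 * BB (vsize (\<sigma> b)) + 6 * gl (vsize (\<sigma> b)) + 9)"
        using 3(4) unfolding \<tau>2 by (meson Suc_le_mono mult_le_mono1 order.trans)
      have "vsize r \<le> BB (vsize (\<sigma> b))"
        using take[of "\<sigma> b" "length (dec_list (lst (\<sigma> b)))"] by (simp add: r_def)
      then have "expr_time sz (Var (b+2)) \<tau>3 \<le> 2 * BB (vsize (\<sigma> b))"
        using le_vsize[of r] r by (simp add: expr_time_def)
      moreover have "n1 \<le> 2 * vsize (\<sigma> b) + hl (vsize (\<sigma> b))" "n2 \<le> 2 * vsize (\<sigma> b) + hi (vsize (\<sigma> b))"
        using 1(4) 2(4) b le_vsize[of "\<sigma> b"] by (simp_all add: expr_time_def)
      ultimately have "n1 + (n2 + (n3 + (1 + expr_time sz (Var (b+2)) \<tau>3))) \<le> H (vsize (\<sigma> b))"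
        using n3 unfolding H_def by linarith
      moreover have "exec sz ?c \<sigma> (n1 + (n2 + (n3 + (1 + expr_time sz (Var (b+2)) \<tau>3)))) (\<tau>3(b := eval_expr (Var (b+2)) \<tau>3))"
        by (intro exec.seq[OF 1(1)] exec.seq[OF 2(1)] exec.seq[OF 3(1)] exec.assign)
      ultimately show "\<exists>n \<tau>. exec sz ?c \<sigma> n \<tau> \<and>
       \<tau> b = foldl (step (\<sigma> b)) (init (\<sigma> b)) (dec_list (lst (\<sigma> b))) \<and>
       (\<forall>x<b. \<tau> x = \<sigma> x) \<and> n \<le> H (vsize (\<sigma> b))"
        using r r_def 1(3) 2(3) 3(3) by (intro exI conjI) (assumption | simp)+
    qed
  qed
qed

text \<open>With \<open>polyl\<close> and \<open>polyb\<close>, lists and truth values keep their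
  HOL types and are encoded only on the outside. So \<open>poly_intros\<close> can follow the syntax
  of ordinary HOL definitions with \<open>map\<close>, \<open>filter\<close> and bounded
  quantifiers.\<close>

definition polyl :: "('n val \<Rightarrow> 'n val list) \<Rightarrow> bool" where
  "polyl L \<longleftrightarrow> polyfun (\<lambda>x. enc_list (L x))"

definition polyb :: "('n val \<Rightarrow> bool) \<Rightarrow> bool" where
  "polyb P \<longleftrightarrow> polyfun (\<lambda>x. truth (P x))"

section \<open>Closure for Boolean tests and list operations\<close>

lemma polyfun_left: "polyfun f \<Longrightarrow> polyfun (\<lambda>x. left (f x))"
  by (rule polyfun_compose[OF polyfun_left0])

lemma polyfun_right: "polyfun f \<Longrightarrow> polyfun (\<lambda>x. right (f x))"
  by (rule polyfun_compose[OF polyfun_right0])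

lemma truth_eq_Leaf: "truth b = Leaf \<longleftrightarrow> \<not> b"
  by (simp add: truth_def)

lemma polyfun_if: "polyb P \<Longrightarrow> polyfun f \<Longrightarrow> polyfun g \<Longrightarrow> polyfun (\<lambda>x. if P x then f x else g x)"
  using polyfun_if0[of "\<lambda>x. truth (P x)" f g] by (simp add: polyb_def truth_eq_Leaf)

lemma polyb_True: "polyb (\<lambda>x. True)"
  using polyfun_Node[OF polyfun_Leaf polyfun_Leaf] by (simp add: polyb_def truth_def)

lemma polyb_False: "polyb (\<lambda>x. False)"
  using polyfun_Leaf by (simp add: polyb_def truth_def)

lemma polyb_if: "polyb P \<Longrightarrow> polyb Q \<Longrightarrow> polyb R \<Longrightarrow> polyb (\<lambda>x. if P x then Q x else R x)"
  using polyfun_if[of P "\<lambda>x. truth (Q x)" "\<lambda>x. truth (R x)"]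
  by (simp add: polyb_def if_distrib[of truth])

lemma polyb_not: "polyb P \<Longrightarrow> polyb (\<lambda>x. \<not> P x)"
  using polyb_if[OF _ polyb_False polyb_True, of P] by (simp add: if_bool_eq_disj disj_commute)

lemma polyb_conj: "polyb P \<Longrightarrow> polyb Q \<Longrightarrow> polyb (\<lambda>x. P x \<and> Q x)"
  using polyb_if[OF _ _ polyb_False, of P Q] by (simp add: if_bool_eq_disj disj_commute)

lemma polyb_disj: "polyb P \<Longrightarrow> polyb Q \<Longrightarrow> polyb (\<lambda>x. P x \<or> Q x)"
  using polyb_not[OF polyb_conj[OF polyb_not polyb_not, of P Q]] by simp

lemma polyb_imp: "polyb P \<Longrightarrow> polyb Q \<Longrightarrow> polyb (\<lambda>x. P x \<longrightarrow> Q x)"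
  using polyb_if[OF _ _ polyb_True, of P Q] by (simp add: if_bool_eq_disj disj_commute)

lemma polyb_eq: "polyfun f \<Longrightarrow> polyfun g \<Longrightarrow> polyb (\<lambda>x. f x = g x)"
  unfolding polyb_def by (rule polyfun_eq0)

lemma truth_num_less:
  "truth (num_op (\<lambda>x y. truth (x < y)) v w \<noteq> Leaf) = num_op (\<lambda>x y. truth (x < y)) v w"
  by (cases v; cases w) (auto simp: truth_def)

lemma polyb_vless: "polyfun f \<Longrightarrow> polyfun g \<Longrightarrow> polyb (\<lambda>x. vless (f x) (g x))"
  unfolding polyb_def vless_def truth_num_less by (rule polyfun_less0)

lemma polyfun_enc_list: "polyl L \<Longrightarrow> polyfun (\<lambda>x. enc_list (L x))"
  by (simp add: polyl_def)

lemma polyfun_foldl: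
  assumes "polyfun (\<lambda>y. step (left y) (left (right y)) (right (right y)))"
    and "polyfun init" and "polyl L" and "is_poly B"
    and "\<And>x vs. vsize (foldl (step x) (init x) vs) \<le> B (vsize x + vsize (enc_list vs))"
  shows "polyfun (\<lambda>x. foldl (step x) (init x) (L x))"
  using polyfun_foldl0[OF assms(1,2) assms(3)[unfolded polyl_def] assms(4,5)] by simp

lemma polyl_rev0: "polyfun f \<Longrightarrow> polyl (\<lambda>x. rev (dec_list (f x)))"
proof -
  have rev: "foldl (\<lambda>acc e. Node e acc) a vs = enc_list (rev vs @ dec_list a)" if "a = enc_list (dec_list a)"
    for a :: "'n val" and vs
    using that by (induction vs arbitrary: a) simp_all
  assume f: "polyfun f"
  have "polyfun (\<lambda>x. foldl (\<lambda>acc e. Node e acc) Leaf (dec_list (f x)))"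
  proof (rule polyfun_foldl0[where step = "\<lambda>x acc e. Node e acc" and init = "\<lambda>x. Leaf"])
    show "polyfun (\<lambda>y. Node (right (right y)) (left (right y)))"
      by (intro polyfun_Node polyfun_left polyfun_right polyfun_id)
    show "vsize (foldl (\<lambda>acc e. Node e acc) Leaf vs) \<le> vsize x + vsize (enc_list vs)" for x vs
      by (simp add: rev vsize_enc_rev)
  qed (intro polyfun_Leaf f is_poly_id)+
  then show "polyl (\<lambda>x. rev (dec_list (f x)))" by (simp add: polyl_def rev)
qed

lemma polyl_rev: "polyl L \<Longrightarrow> polyl (\<lambda>x. rev (L x))"
  using polyl_rev0[OF polyfun_enc_list, of L] by simp

text \<open>Decoding and encoding again is not the identity on values that end in a number.
  Reversing twice performs this normalization.\<close>

lemma polyl_dec_list: "polyfun f \<Longrightarrow> polyl (\<lambda>x. dec_list (f x))"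
  using polyl_rev[OF polyl_rev0, of f] by simp

text \<open>If every step adds at most an amount that depends on environment and element, but not on
  the accumulator, then the growth is at most the length of the list times a polynomial, and a size
  bound comes for free. The program is a left fold over the reversed list.\<close>

lemma polyfun_foldr:
  assumes step: "polyfun (\<lambda>y. step (left y) (left (right y)) (right (right y)))"
    and init: "polyfun init" and L: "polyl L" and Q: "is_poly Q"
    and size: "\<And>x e a. vsize (step x e a) \<le> vsize a + Q (vsize x + vsize e)"
  shows "polyfun (\<lambda>x. foldr (step x) (L x) (init x))"
proof -
  obtain gi where gi: "is_poly gi" "\<And>v. vsize (init v) \<le> gi (vsize v)" using polyfun_size[OF init] by blast
  have bd: "vsize (foldr (step x) vs (init x)) \<le> gi (vsize x) + length vs * Q q"
    if "\<And>e. e \<in> set vs \<Longrightarrow> vsize x + vsize e \<le> q" for x vs q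
    using that
  proof (induction vs)
    case (Cons e vs)
    have "Q (vsize x + vsize e) \<le> Q q" using Cons.prems by (intro is_poly_mono[OF Q]) simp
    moreover have "vsize (foldr (step x) vs (init x)) \<le> gi (vsize x) + length vs * Q q"
      using Cons by simp
    ultimately show ?case
      using size[of x e "foldr (step x) vs (init x)"] by simp
  qed (simp add: gi(2))
  have "polyfun (\<lambda>x. foldl (\<lambda>a e. step x e a) (init x) (rev (L x)))"
  proof (rule polyfun_foldl[where step = "\<lambda>x a e. step x e a"])
    have "polyfun (\<lambda>y. Node (left y) (Node (right (right y)) (left (right y))))"
      by (intro polyfun_Node polyfun_left polyfun_right polyfun_id)
    from polyfun_compose[OF step this]
    show "polyfun (\<lambda>y. step (left y) (right (right y)) (left (right y)))" by simp
    show "polyl (\<lambda>x. rev (L x))" by (rule polyl_rev[OF L])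
    show "is_poly (\<lambda>n. gi n + n * Q n)" by (intro is_poly_intros gi Q)
    fix x and vs :: "'n val list"
    let ?n = "vsize x + vsize (enc_list vs)"
    have "vsize (foldl (\<lambda>a e. step x e a) (init x) vs) \<le> gi (vsize x) + length vs * Q ?n"
      using bd[of "rev vs" x ?n] vsize_mem[of _ vs] by (simp add: foldr_conv_foldl)
    moreover have "length vs * Q ?n \<le> ?n * Q ?n"
      using length_le_vsize[of vs] by (intro mult_le_mono1) simp
    moreover have "gi (vsize x) \<le> gi ?n" by (intro is_poly_mono[OF gi(1)]) simp
    ultimately show "vsize (foldl (\<lambda>a e. step x e a) (init x) vs) \<le> gi ?n + ?n * Q ?n" by linarith
  qed (rule init)
  then show ?thesis by (simp add: foldr_conv_foldl)
qed

lemma polyfun_foldr_Node: "polyl L \<Longrightarrow> polyfun f \<Longrightarrow> polyfun (\<lambda>x. foldr Node (L x) (f x))"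
  by (rule polyfun_foldr[where step = "\<lambda>x. Node" and Q = "\<lambda>n. n + 1"])
    (auto intro!: polyfun_Node polyfun_left polyfun_right polyfun_id is_poly_intros)

lemma foldr_Node: "foldr Node vs (enc_list ws) = enc_list (vs @ ws)"
  by (simp add: enc_list_def)

lemma polyl_append: "polyl L \<Longrightarrow> polyl M \<Longrightarrow> polyl (\<lambda>x. L x @ M x)"
  using polyfun_foldr_Node[of L "\<lambda>x. enc_list (M x)"] by (simp add: polyl_def foldr_Node)

lemma polyl_Nil: "polyl (\<lambda>x. [])"
  by (simp add: polyl_def polyfun_Leaf)

lemma polyl_Cons: "polyfun f \<Longrightarrow> polyl L \<Longrightarrow> polyl (\<lambda>x. f x # L x)"
  by (simp add: polyl_def polyfun_Node)

lemma polyl_if: "polyb P \<Longrightarrow> polyl L \<Longrightarrow> polyl M \<Longrightarrow> polyl (\<lambda>x. if P x then L x else M x)"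
  using polyfun_if[of P "\<lambda>x. enc_list (L x)" "\<lambda>x. enc_list (M x)"]
  by (simp add: polyl_def if_distrib[of enc_list])

lemma polyl_map:
  assumes F: "polyfun (\<lambda>y. F (left y) (right y))" and L: "polyl L"
  shows "polyl (\<lambda>x. map (F x) (L x))"
proof -
  obtain g where g: "is_poly g" "\<And>y. vsize (F (left y) (right y)) \<le> g (vsize y)"
    using polyfun_size[OF F] by blast
  have "polyfun (\<lambda>x. foldr (\<lambda>e a. Node (F x e) a) (L x) Leaf)"
  proof (rule polyfun_foldr[where step = "\<lambda>x e a. Node (F x e) a" and init = "\<lambda>x. Leaf"])
    have "polyfun (\<lambda>y. Node (left y) (left (right y)))"
      by (intro polyfun_Node polyfun_left polyfun_right polyfun_id)
    from polyfun_compose[OF F this]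
    show "polyfun (\<lambda>y. Node (F (left y) (left (right y))) (right (right y)))"
      by (intro polyfun_Node polyfun_right polyfun_id) simp
    show "is_poly (\<lambda>n. Suc (g (Suc n)))"
      by (intro is_poly_intros is_poly_compose[OF g(1)])
    show "vsize (Node (F x e) a) \<le> vsize a + Suc (g (Suc (vsize x + vsize e)))" for x e a
      using g(2)[of "Node x e"] by simp
  qed (intro polyfun_Leaf L)+
  moreover have "foldr (\<lambda>e a. Node (F x e) a) vs Leaf = enc_list (map (F x) vs)" for x vs
    by (induction vs) simp_all
  ultimately show ?thesis by (simp add: polyl_def)
qed

lemma polyl_filter:
  assumes P: "polyb (\<lambda>y. P (left y) (right y))" and L: "polyl L"
  shows "polyl (\<lambda>x. filter (P x) (L x))"
proof -
  have "polyfun (\<lambda>x. foldr (\<lambda>e a. if P x e then Node e a else a) (L x) Leaf)"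
  proof (rule polyfun_foldr[where step = "\<lambda>x e a. if P x e then Node e a else a" and init = "\<lambda>x. Leaf"
        and Q = Suc])
    have "polyfun (\<lambda>y. Node (left y) (left (right y)))"
      by (intro polyfun_Node polyfun_left polyfun_right polyfun_id)
    from polyfun_compose[OF P[unfolded polyb_def] this]
    show "polyfun (\<lambda>y. if P (left y) (left (right y)) then Node (left (right y)) (right (right y)) else right (right y))"
      by (intro polyfun_if polyfun_Node polyfun_left polyfun_right polyfun_id) (simp add: polyb_def)
    show "is_poly Suc"
      using is_poly_Suc[OF is_poly_id] by simp
  qed (auto intro!: polyfun_Leaf L)
  moreover have "foldr (\<lambda>e a. if P x e then Node e a else a) vs Leaf = enc_list (filter (P x) vs)" for x vs
    by (induction vs) simp_all
  ultimately show ?thesis by (simp add: polyl_def)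
qed

lemma polyl_concat_map:
  assumes G: "polyl (\<lambda>y. G (left y) (right y))" and L: "polyl L"
  shows "polyl (\<lambda>x. concat (map (G x) (L x)))"
proof -
  obtain g where g: "is_poly g" "\<And>y. vsize (enc_list (G (left y) (right y))) \<le> g (vsize y)"
    using polyfun_size[OF polyfun_enc_list[OF G]] by blast
  have "polyfun (\<lambda>x. foldr (\<lambda>e a. foldr Node (G x e) a) (L x) Leaf)"
  proof (rule polyfun_foldr[where step = "\<lambda>x e a. foldr Node (G x e) a" and init = "\<lambda>x. Leaf"])
    have "polyfun (\<lambda>y. Node (left y) (left (right y)))"
      by (intro polyfun_Node polyfun_left polyfun_right polyfun_id)
    from polyfun_compose[OF polyfun_enc_list[OF G] this]
    show "polyfun (\<lambda>y. foldr Node (G (left y) (left (right y))) (right (right y)))"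
      by (intro polyfun_foldr_Node polyfun_right polyfun_id) (simp add: polyl_def)
    show "is_poly (\<lambda>n. g (Suc n))"
      by (intro is_poly_intros is_poly_compose[OF g(1)])
    have "vsize (foldr Node vs a) \<le> vsize a + vsize (enc_list vs)" for vs a
      by (induction vs) auto
    then show "vsize (foldr Node (G x e) a) \<le> vsize a + g (Suc (vsize x + vsize e))" for x e a
      using g(2)[of "Node x e"] by simp (meson add_left_mono order.trans)
  qed (intro polyfun_Leaf L)+
  moreover have "foldr (\<lambda>e a. foldr Node (G x e) a) vs Leaf = enc_list (concat (map (G x) vs))" for x vs
    by (induction vs) (simp_all add: foldr_Node)
  ultimately show ?thesis by (simp add: polyl_def)
qed

lemma polyb_bex:
  assumes "polyb (\<lambda>y. P (left y) (right y))" and "polyl L"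
  shows "polyb (\<lambda>x. \<exists>e\<in>set (L x). P x e)"
proof -
  have "polyb (\<lambda>x. enc_list (filter (P x) (L x)) \<noteq> Leaf)"
    by (intro polyb_not polyb_eq polyfun_enc_list polyl_filter assms polyfun_Leaf)
  moreover have "enc_list (filter (P x) vs) \<noteq> Leaf \<longleftrightarrow> (\<exists>e\<in>set vs. P x e)" for x vs
    by (induction vs) auto
  ultimately show ?thesis by simp
qed

lemma polyb_ball:
  assumes "polyb (\<lambda>y. P (left y) (right y))" and "polyl L"
  shows "polyb (\<lambda>x. \<forall>e\<in>set (L x). P x e)"
proof -
  have "polyb (\<lambda>x. \<not> (\<exists>e\<in>set (L x). \<not> P x e))"
    by (intro polyb_not polyb_bex assms)
  then show ?thesis by simp
qed

lemmas poly_intros = polyfun_id polyfun_Leaf polyfun_zero polyfun_Node polyfun_left polyfun_right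
  polyfun_vadd polyfun_if polyfun_enc_list polyl_dec_list polyl_append polyl_Nil polyl_Cons polyl_map
  polyl_filter polyl_concat_map polyb_True polyb_not polyb_conj polyb_disj polyb_imp polyb_eq
  polyb_vless polyb_bex polyb_ball

section \<open>The program\<close>

text \<open>A label consists of a vertex, a distance and a path. In the list \<open>S\<close> of labels, a label
  precedes the older, worse labels of the same vertex.\<close>

definition vrelax :: "'n val \<Rightarrow> 'n val \<Rightarrow> 'n val" where
  "vrelax S a =
     (let l = left (enc_list (filter (\<lambda>e. left e = left (right a)) (dec_list S)));
          v = left (right (right a));
          d = vadd (left (right l)) (left (right (right (right a))))
      in if l = Leaf \<or> (\<exists>e\<in>set (dec_list S). left e = v \<and> \<not> vless d (left (right e))) then S
         else Node (Node v (Node d (Node (left a) (right (right l))))) S)"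

text \<open>The list \<open>As\<close> also serves as a loop counter: one round per arc is enough,
  since a simple path has at most \<open>length As\<close> arcs.\<close>

definition vbf :: "'n val \<Rightarrow> 'n val list \<Rightarrow> 'n val" where
  "vbf s As = foldl (\<lambda>S _. foldl vrelax S As) (Node (Node s (Node (Num 0) Leaf)) Leaf) As"

definition vshortest :: "'n val \<Rightarrow> 'n val \<Rightarrow> 'n val list \<Rightarrow> 'n val" where
  "vshortest s t As = left (enc_list (filter (\<lambda>e. left e = t) (dec_list (vbf s As))))"

text \<open>A relaxation adds one arc name to a path and one cost to a distance, and writes a new
  vertex; these are the three \<open>q\<close>. Thus the largest label grows by a summand only. A
  constant factor per relaxation would make sizes exponential, so the additive form of
  \<open>mu_add\<close> is essential here.\<close>

lemma vsize_vrelax: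
  assumes S: "vsize S \<le> l" "\<forall>e\<in>set (dec_list S). vsize e \<le> m" and "1 \<le> m"
    and a: "vsize a \<le> q"
  shows "vsize (vrelax S a) \<le> l + (m + (3 * q + K + 5)) + 1"
    and "\<forall>e\<in>set (dec_list (vrelax S a)). vsize e \<le> m + (3 * q + K + 5)"
proof -
  define l' where "l' = left (enc_list (filter (\<lambda>e. left e = left (right a)) (dec_list S)))"
  let ?v = "left (right (right a))"
  define d where "d = vadd (left (right l')) (left (right (right (right a))))"
  define e where "e = Node ?v (Node d (Node (left a) (right (right l'))))"
  have "vsize l' \<le> m"
  proof (cases "filter (\<lambda>e. left e = left (right a)) (dec_list S)")
    case (Cons e es)
    then have "e \<in> set (dec_list S)" by (metis filter_eq_ConsD in_set_conv_decomp)
    then show ?thesis using S(2) Cons by (simp add: l'_def)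
  qed (use \<open>1 \<le> m\<close> in \<open>simp add: l'_def\<close>)
  \<comment> \<open>Distance and path are disjoint parts of \<open>l'\<close> and share the bound
    \<open>m\<close>. Bounding each of them by \<open>m\<close> would double the label.\<close>
  moreover have "vsize (left (right l')) + vsize (right (right l')) \<le> Suc (vsize l')"
    using vsize_left_right[of "right l'"] vsize_right[of l'] by linarith
  moreover have "vsize d \<le> vsize (left (right l')) + vsize (left (right (right (right a)))) + K"
    unfolding d_def by (rule vsize_vadd)
  moreover have "vsize ?v \<le> q" "vsize (left a) \<le> q" "vsize (left (right (right (right a)))) \<le> q"
    using a vsize_left vsize_right order.trans by meson+
  ultimately have e: "vsize e \<le> m + (3 * q + K + 5)" unfolding e_def by simp
  have r: "vrelax S a = S \<or> vrelax S a = Node e S"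
    by (simp add: vrelax_def Let_def e_def d_def l'_def)
  show "vsize (vrelax S a) \<le> l + (m + (3 * q + K + 5)) + 1" using r e S(1) by auto
  show "\<forall>e\<in>set (dec_list (vrelax S a)). vsize e \<le> m + (3 * q + K + 5)"
    using r e S(2) by (auto intro: trans_le_add1)
qed

lemma vsize_foldl_vrelax:
  assumes "vsize S \<le> l" "\<forall>e\<in>set (dec_list S). vsize e \<le> m" and "1 \<le> m"
    and "\<forall>a\<in>set As. vsize a \<le> q" and "C = 3 * q + K + 5"
  shows "vsize (foldl vrelax S As) \<le> l + length As * (m + length As * C + 1) \<and>
    (\<forall>e\<in>set (dec_list (foldl vrelax S As)). vsize e \<le> m + length As * C)"
  using assms(1-4)
proof (induction As arbitrary: S l m)
  case (Cons a As)
  let ?n = "length As"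
  have "vsize (vrelax S a) \<le> l + (m + C) + 1"
    "\<forall>e\<in>set (dec_list (vrelax S a)). vsize e \<le> m + C"
    using vsize_vrelax[of S l m a q] Cons.prems assms(5) by auto
  from Cons.IH[OF this] Cons.prems
  have IH: "vsize (foldl vrelax (vrelax S a) As) \<le> l + (m + C) + 1 + ?n * (m + C + ?n * C + 1)"
    "\<forall>e\<in>set (dec_list (foldl vrelax (vrelax S a) As)). vsize e \<le> m + C + ?n * C"
    by auto
  have "(m + C) + 1 + ?n * (m + C + ?n * C + 1) \<le> Suc ?n * (m + Suc ?n * C + 1)"
    by (simp add: algebra_simps)
  then show ?case using IH by (auto simp: algebra_simps)
qed auto

text \<open>Flattening the two nested loops lets one fold with one size bound cover the quadratic
  number of relaxations.\<close>

lemma vbf_conv: "vbf s As = foldl vrelax (Node (Node s (Node (Num 0) Leaf)) Leaf) (concat (map (\<lambda>_. As) As))"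
proof -
  have "foldl (\<lambda>S _. foldl vrelax S As) S Bs = foldl vrelax S (concat (map (\<lambda>_. As) Bs))"
    for S :: "'n val" and Bs :: "'n val list"
    by (induction Bs arbitrary: S) auto
  then show ?thesis by (simp add: vbf_def)
qed

text \<open>The initial list of labels has size exactly \<open>vsize s + mu 0 + 6\<close>, the
  origin of \<open>c\<close>.\<close>

lemma vsize_foldl_vrelax_init:
  "vsize (foldl vrelax (Node (Node s (Node (Num 0) Leaf)) Leaf) As)
     \<le> vsize s + c + length As * (vsize s + c + length As * (3 * vsize (enc_list As) + K + 5) + 1)"
  if "c = mu 0 + 6"
  using vsize_foldl_vrelax[of "Node (Node s (Node (Num 0) Leaf)) Leaf" "vsize s + c"
      "vsize s + c" As "vsize (enc_list As)" "3 * vsize (enc_list As) + K + 5"] vsize_mem[of _ As] that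
  by auto

lemma polyfun_vrelax: "polyfun f \<Longrightarrow> polyfun g \<Longrightarrow> polyfun (\<lambda>x. vrelax (f x) (g x))"
proof -
  have "polyfun (\<lambda>y. vrelax (left y) (right y))"
    unfolding vrelax_def Let_def by (intro poly_intros)
  from polyfun_compose[OF this polyfun_Node, of f g]
  show "polyfun f \<Longrightarrow> polyfun g \<Longrightarrow> polyfun (\<lambda>x. vrelax (f x) (g x))" by simp
qed

lemma polyfun_vbf:
  assumes s: "polyfun s" and L: "polyl L"
  shows "polyfun (\<lambda>x. vbf (s x) (L x))"
proof -
  obtain g where g: "is_poly g" "\<And>v. vsize (s v) \<le> g (vsize v)" using polyfun_size[OF s] by blast
  define c where "c = mu 0 + 6"
  show ?thesis unfolding vbf_conv
  proof (rule polyfun_foldl[where step = "\<lambda>_. vrelax" and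
        B = "\<lambda>n. g n + c + n * (g n + c + n * (3 * n + K + 5) + 1)"])
    show "polyl (\<lambda>x. concat (map (\<lambda>_. L x) (L x)))"
    proof (rule polyl_concat_map[OF _ L])
      show "polyl (\<lambda>y. L (left y))"
        using polyfun_compose[OF L[unfolded polyl_def] polyfun_left0] by (simp add: polyl_def)
    qed
    show "is_poly (\<lambda>n. g n + c + n * (g n + c + n * (3 * n + K + 5) + 1))"
      by (intro is_poly_intros g)
    fix x and vs :: "'n val list"
    let ?n = "vsize x + vsize (enc_list vs)"
    have "g (vsize x) \<le> g ?n" by (intro is_poly_mono[OF g(1)]) simp
    then have "vsize (s x) \<le> g ?n" using g(2)[of x] by linarith
    moreover have "length vs \<le> ?n" "vsize (enc_list vs) \<le> ?n" using length_le_vsize[of vs] by auto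
    ultimately have "vsize (s x) + c + length vs * (vsize (s x) + c + length vs * (3 * vsize (enc_list vs) + K + 5) + 1)
      \<le> g ?n + c + ?n * (g ?n + c + ?n * (3 * ?n + K + 5) + 1)"
      by (intro add_mono mult_le_mono order.refl)
    then show "vsize (foldl vrelax (Node (Node (s x) (Node (Num 0) Leaf)) Leaf) vs)
      \<le> g ?n + c + ?n * (g ?n + c + ?n * (3 * ?n + K + 5) + 1)"
      using vsize_foldl_vrelax_init[OF c_def, of "s x" vs] by linarith
  qed (intro polyfun_vrelax poly_intros s)+
qed

lemma polyfun_vshortest:
  assumes "polyfun s" "polyfun t" "polyl L"
  shows "polyfun (\<lambda>x. vshortest (s x) (t x) (L x))"
proof -
  have t: "polyfun (\<lambda>y. t (left y))" using polyfun_compose[OF assms(2) polyfun_left0] .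
  show ?thesis unfolding vshortest_def by (intro poly_intros polyfun_vbf assms t)
qed

text \<open>For the undirected problems, every edge becomes a pair of opposite arcs; for the
  superset problems, negative costs are replaced by 0.\<close>

definition varcs :: "bool \<Rightarrow> bool \<Rightarrow> 'n val \<Rightarrow> 'n val list" where
  "varcs und super x =
     (let As = dec_list (left (right x));
          Bs = (if und then As @ map (\<lambda>a. Node (left a) (Node (left (right (right a)))
                  (Node (left (right a)) (right (right (right a)))))) As else As)
      in if super then map (\<lambda>a. if vless (left (right (right (right a)))) (Num 0)
           then Node (left a) (Node (left (right a)) (Node (left (right (right a))) (Node (Num 0) Leaf)))
           else a) Bs
         else Bs)"

text \<open>Membership is spelled out as a bounded quantifier over an equation, the form to which
  \<open>polyb_bex\<close> and \<open>polyb_eq\<close> apply. The same device appears in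
  \<open>vpaths\<close>.\<close>

definition vsubset :: "'n val \<Rightarrow> 'n val \<Rightarrow> bool" where
  "vsubset C C' \<longleftrightarrow> (\<forall>e\<in>set (dec_list C). \<exists>e'\<in>set (dec_list C'). e = e')"

text \<open>The same class may be listed several times and in different orders, so minimality is
  expressed by inclusions. All copies of a minimal class are kept; they select the same arcs, hence
  the same path, and an answer is only read as a set.\<close>

definition vminimal :: "'n val \<Rightarrow> 'n val list" where
  "vminimal x = (let Cs = dec_list (left (right (right x))) in
     filter (\<lambda>C. \<forall>C'\<in>set Cs. vsubset C' C \<longrightarrow> vsubset C C') Cs)"

definition vpaths :: "bool \<Rightarrow> bool \<Rightarrow> 'n val \<Rightarrow> 'n val list" where
  "vpaths und super x =
     map (\<lambda>M. vshortest (left (right (right (right x)))) (left (right (right (right (right x)))))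
       (filter (\<lambda>a. \<exists>e\<in>set (dec_list M). left a = e) (varcs und super x))) (vminimal x)"

text \<open>For minimal classes, one inclusion already means equality as sets, so the first test
  finds two different minimal classes inside a common class. The outer \<open>Node\<close> with
  \<open>Leaf\<close> encodes \<open>Some\<close>, which distinguishes an empty answer from
  infeasibility.\<close>

definition vmain :: "bool \<Rightarrow> bool \<Rightarrow> 'n val \<Rightarrow> 'n val" where
  "vmain und super x =
     (if (\<not> super \<and> (\<exists>C\<in>set (dec_list (left (right (right x)))). \<exists>M\<in>set (vminimal x). \<exists>M'\<in>set (vminimal x).
            vsubset M C \<and> vsubset M' C \<and> \<not> vsubset M M')) \<or>
         (\<exists>l\<in>set (vpaths und super x). l = Leaf) then Leaf
      else Node (enc_list (concat (map (\<lambda>l. dec_list (right (right l))) (vpaths und super x)) @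
        (if super then map left (filter (\<lambda>a. vless (left (right (right (right a)))) (Num 0))
           (dec_list (left (right x)))) else []))) Leaf)"

section \<open>Polynomial running time of the program\<close>

lemma polyb_const: "polyb (\<lambda>x. b)"
  by (cases b) (simp_all add: polyb_True polyb_False)

lemma polyb_vsubset: "polyfun f \<Longrightarrow> polyfun g \<Longrightarrow> polyb (\<lambda>x. vsubset (f x) (g x))"
proof -
  have "polyb (\<lambda>y. vsubset (left y) (right y))"
    unfolding vsubset_def by (intro poly_intros)
  from polyfun_compose[OF this[unfolded polyb_def] polyfun_Node, of f g]
  show "polyfun f \<Longrightarrow> polyfun g \<Longrightarrow> polyb (\<lambda>x. vsubset (f x) (g x))" by (simp add: polyb_def)
qed

lemma polyl_compose: "polyl L \<Longrightarrow> polyfun f \<Longrightarrow> polyl (\<lambda>x. L (f x))"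
  using polyfun_compose[of "\<lambda>x. enc_list (L x)" f] by (simp add: polyl_def)

lemma polyl_varcs: "polyfun f \<Longrightarrow> polyl (\<lambda>x. varcs und super (f x))"
proof (rule polyl_compose)
  show "polyl (varcs und super)"
    unfolding varcs_def Let_def by (intro poly_intros polyb_const polyl_if)
qed

lemma polyl_vminimal: "polyfun f \<Longrightarrow> polyl (\<lambda>x. vminimal (f x))"
proof (rule polyl_compose)
  show "polyl vminimal"
    unfolding vminimal_def Let_def by (intro poly_intros polyb_vsubset)
qed

lemma polyl_vpaths: "polyfun f \<Longrightarrow> polyl (\<lambda>x. vpaths und super (f x))"
proof (rule polyl_compose)
  show "polyl (vpaths und super)"
    unfolding vpaths_def Let_def
    by (intro poly_intros polyfun_vshortest polyl_varcs polyl_vminimal)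
qed

lemma polyfun_vmain: "polyfun (vmain und super)"
  unfolding vmain_def
  by (intro poly_intros polyb_const polyl_if polyb_vsubset polyl_vpaths polyl_vminimal)

lemma polytime_solvableI:
  assumes "polyfun f"
    and "\<And>I. P I \<Longrightarrow> \<exists>ans. f (enc_input I) = enc_answer ans \<and> problem I ans"
  shows "polytime_solvable sz P problem"
proof -
  obtain c g where "is_poly g" and c: "\<And>\<sigma>. \<exists>n \<tau>. exec sz c \<sigma> n \<tau> \<and> \<tau> 0 = f (\<sigma> 0) \<and>
     (\<forall>x<0. \<tau> x = \<sigma> x) \<and> n \<le> g (vsize (\<sigma> 0))"
    using polyfun_time[OF assms(1), of 0] by blast
  then obtain p where p: "g = poly p" unfolding is_poly_def by blast
  show ?thesis unfolding polytime_solvable_def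
  proof (intro exI[of _ c] exI[of _ p] allI impI)
    fix I assume "P I"
    then obtain ans where ans: "f (enc_input I) = enc_answer ans" "problem I ans" using assms(2) by blast
    obtain n \<tau> where n: "exec sz c ((\<lambda>_. Leaf)(0 := enc_input I)) n \<tau>" "\<tau> 0 = f (enc_input I)"
      "n \<le> g (vsize (enc_input I))"
      using c[of "(\<lambda>_. Leaf)(0 := enc_input I)"] by auto
    have "n \<le> poly p (val_size sz (enc_input I))"
      using n(3) is_poly_mono[OF \<open>is_poly g\<close> vsize_le[of "enc_input I"]] p by simp
    then show "\<exists>n \<tau> ans. exec sz c ((\<lambda>_. Leaf)(0 := enc_input I)) n \<tau> \<and>
      n \<le> poly p (val_size sz (enc_input I)) \<and> \<tau> 0 = enc_answer ans \<and> problem I ans"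
      using n ans by auto
  qed
qed

end

lemma cost_model_unit: "cost_model unit_size (\<lambda>_. 1) 0"
  by unfold_locales (auto simp: unit_size_def)

section \<open>Shortest paths\<close>

text \<open>Quadruples are arcs with name, tail, head and cost. Vertices \<open>X\<close> and arcs \<open>P\<close> of a path from
  \<open>u\<close> to \<open>v\<close> of cost \<open>d\<close> are listed backwards.\<close>

inductive spath ::
    "('i \<times> 'v \<times> 'v \<times> 'n::linordered_idom) set \<Rightarrow> 'v \<Rightarrow> 'v \<Rightarrow> 'v list \<Rightarrow> 'i list \<Rightarrow> 'n \<Rightarrow> bool"
  for T u where
  Nil: "spath T u u [u] [] 0"
| Cons: "spath T u v X P d \<Longrightarrow> (j, v, w, q) \<in> T \<Longrightarrow> w \<notin> set X \<Longrightarrow> spath T u w (w # X) (j # P) (d + q)"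

text \<open>A cycle is a simple path together with a closing arc; the trivial path accounts for
  loops. If an undirected edge becomes two opposite arcs, going back and forth along it counts as a
  cycle, so an edge of negative cost would violate this condition.\<close>

definition nonneg_cycles :: "('i \<times> 'v \<times> 'v \<times> 'n::linordered_idom) set \<Rightarrow> bool" where
  "nonneg_cycles T \<longleftrightarrow> (\<forall>u v X P d j q. spath T u v X P d \<longrightarrow> (j, v, u, q) \<in> T \<longrightarrow> 0 \<le> d + q)"

lemma spath_ends: "spath T u v X P d \<Longrightarrow> u \<in> set X \<and> v \<in> set X"
  by (induction rule: spath.induct) auto

lemma spath_length: "spath T u v X P d \<Longrightarrow> length X = Suc (length P) \<and> distinct X"
  by (induction rule: spath.induct) auto

lemma spath_restrict:
  "spath {a \<in> T. fst a \<in> M} u v X P d \<longleftrightarrow> spath T u v X P d \<and> set P \<subseteq> M"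
proof
  assume "spath {a \<in> T. fst a \<in> M} u v X P d"
  then show "spath T u v X P d \<and> set P \<subseteq> M"
    by induction (auto intro: spath.intros)
next
  assume "spath T u v X P d \<and> set P \<subseteq> M"
  then have "spath T u v X P d" "set P \<subseteq> M" by auto
  then show "spath {a \<in> T. fst a \<in> M} u v X P d"
    by induction (auto intro: spath.intros)
qed

lemma nonneg_cycles_subset:
  assumes "nonneg_cycles T" and "T' \<subseteq> T"
  shows "nonneg_cycles T'"
proof -
  have "spath T' u v X P d \<Longrightarrow> spath T u v X P d" for u v X P d
    by (induction rule: spath.induct) (use assms(2) in \<open>auto intro: spath.intros\<close>)
  then show ?thesis using assms unfolding nonneg_cycles_def by blast
qed

lemma nonneg_cycles_nonneg:
  assumes "\<And>j u v q. (j, u, v, q) \<in> T \<Longrightarrow> 0 \<le> q"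
  shows "nonneg_cycles T"
proof -
  have "spath T u v X P d \<Longrightarrow> 0 \<le> d" for u v X P d
    by (induction rule: spath.induct) (use assms in auto)
  then show ?thesis using assms unfolding nonneg_cycles_def by (meson add_nonneg_nonneg)
qed

text \<open>Worse labels are kept instead of overwritten: the set of labels only grows, and what
  \<open>labels_ok\<close> asserts about an old label stays true.\<close>

definition relax :: "('v \<times> 'n \<times> 'i list) list \<Rightarrow> 'i \<times> 'v \<times> 'v \<times> 'n::linordered_idom \<Rightarrow>
    ('v \<times> 'n \<times> 'i list) list" where
  "relax S a = (case a of (j, u, v, q) \<Rightarrow>
     (case find (\<lambda>l. fst l = u) S of
        None \<Rightarrow> S
      | Some l \<Rightarrow> if \<exists>l'\<in>set S. fst l' = v \<and> \<not> fst (snd l) + q < fst (snd l') then S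
           else (v, fst (snd l) + q, j # snd (snd l)) # S))"

definition bellman_ford :: "'v \<Rightarrow> ('i \<times> 'v \<times> 'v \<times> 'n::linordered_idom) list \<Rightarrow> ('v \<times> 'n \<times> 'i list) list" where
  "bellman_ford s As = foldl (\<lambda>S _. foldl relax S As) [(s, 0, [])] As"

definition shortest :: "'v \<Rightarrow> 'v \<Rightarrow> ('i \<times> 'v \<times> 'v \<times> 'n::linordered_idom) list \<Rightarrow> ('v \<times> 'n \<times> 'i list) option" where
  "shortest s t As = find (\<lambda>l. fst l = t) (bellman_ford s As)"

text \<open>Recording, for every vertex \<open>w\<close> on the path of a label, a label of \<open>w\<close> that is no worse than
  the initial segment of the path makes the invariant monotone in the set of labels. It forces
  relaxation to keep paths simple, as cycles cannot improve a label.\<close>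

definition labels_ok :: "('i \<times> 'v \<times> 'v \<times> 'n::linordered_idom) set \<Rightarrow> 'v \<Rightarrow> ('v \<times> 'n \<times> 'i list) set \<Rightarrow> bool" where
  "labels_ok T s L \<longleftrightarrow> (\<forall>v d P. (v, d, P) \<in> L \<longrightarrow> (\<exists>X. spath T s v X P d \<and>
     (\<forall>w\<in>set X. \<exists>dl Pl X' P' d'. (w, dl, Pl) \<in> L \<and> spath T w v X' P' d' \<and> set X' \<subseteq> set X \<and> dl + d' \<le> d)))"

definition newest_best :: "('v \<times> 'n::linordered_idom \<times> 'i list) list \<Rightarrow> bool" where
  "newest_best = sorted_wrt (\<lambda>l l'. fst l = fst l' \<longrightarrow> fst (snd l) < fst (snd l'))"

lemma newest_best_find:
  assumes "newest_best S" and "l \<in> set S"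
  obtains l' where "find (\<lambda>l. fst l = fst l') S = Some l'" "l' \<in> set S" "fst l' = fst l"
    "fst (snd l') \<le> fst (snd l)"
proof -
  have "\<exists>l'. find (\<lambda>l'. fst l' = fst l) S = Some l' \<and> l' \<in> set S \<and> fst l' = fst l \<and> fst (snd l') \<le> fst (snd l)"
    using assms by (induction S) (auto simp: newest_best_def less_imp_le)
  then show thesis using that by metis
qed

section \<open>Invariants and convergence of Bellman-Ford\<close>

lemma relax_mono: "set S \<subseteq> set (relax S a)"
  by (cases a) (auto simp: relax_def split: option.split)

lemma relax_newest_best: "newest_best S \<Longrightarrow> newest_best (relax S a)"
  by (cases a) (auto simp: relax_def newest_best_def split: option.split)

lemma relax_ok:
  assumes ok: "labels_ok T s (set S)" and a: "a \<in> T" and T: "nonneg_cycles T"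
  shows "labels_ok T s (set (relax S a))"
proof -
  obtain j u v q where a': "a = (j, u, v, q)" by (cases a)
  consider "relax S a = S" | l where "l \<in> set S" "fst l = u"
    "\<forall>l'\<in>set S. fst l' = v \<longrightarrow> fst (snd l) + q < fst (snd l')"
    "relax S a = (v, fst (snd l) + q, j # snd (snd l)) # S"
  proof (cases "find (\<lambda>l. fst l = u) S")
    case None
    then show thesis using that(1) by (simp add: relax_def a')
  next
    case (Some l)
    then have "l \<in> set S" "fst l = u" by (auto simp: find_Some_iff)
    then show thesis using that Some
      by (cases "\<exists>l'\<in>set S. fst l' = v \<and> \<not> fst (snd l) + q < fst (snd l')") (auto simp: relax_def a')
  qed
  then show ?thesis
  proof cases
    case 2
    obtain d P where l: "l = (u, d, P)" using 2(2) by (cases l) auto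
    obtain X where X: "spath T s u X P d" and
      seg: "\<forall>w\<in>set X. \<exists>dl Pl X' P' d'. (w, dl, Pl) \<in> set S \<and> spath T w u X' P' d' \<and> set X' \<subseteq> set X \<and> dl + d' \<le> d"
      using ok 2(1) l unfolding labels_ok_def by blast
    \<comment> \<open>If \<open>v\<close> were on the path to \<open>u\<close>, the invariant would
      give a label \<open>dl\<close> of \<open>v\<close> and a path from \<open>v\<close> to
      \<open>u\<close> of cost \<open>d'\<close> with \<open>dl + d' \<le> d\<close>. The arc closes
      a cycle of cost \<open>d' + q \<ge> 0\<close>, so \<open>dl \<le> d + q\<close>, against the
      strict improvement.\<close>
    have v: "v \<notin> set X"
    proof
      assume "v \<in> set X"
      then obtain dl Pl X' P' d' where *: "(v, dl, Pl) \<in> set S" "spath T v u X' P' d'" "dl + d' \<le> d"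
        using seg by blast
      have "0 \<le> d' + q" using T *(2) a a' unfolding nonneg_cycles_def by blast
      moreover have "d + q < dl" using 2(3) *(1) l by force
      ultimately show False using *(3) by (smt (verit) add.assoc add_less_cancel_right add_le_cancel_left add_mono_thms_linordered_field(4) le_add_same_cancel1 not_le order.trans)
    qed
    define L where "L = set (relax S a)"
    have L: "L = insert (v, d + q, j # P) (set S)" using 2(4) l by (simp add: L_def)
    have new: "\<exists>X. spath T s v X (j # P) (d + q) \<and>
     (\<forall>w\<in>set X. \<exists>dl Pl X' P' d'. (w, dl, Pl) \<in> L \<and> spath T w v X' P' d' \<and> set X' \<subseteq> set X \<and> dl + d' \<le> d + q)"
    proof (intro exI[of _ "v # X"] conjI ballI)
      show "spath T s v (v # X) (j # P) (d + q)" using X a a' v by (auto intro: spath.Cons)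
      fix w assume w: "w \<in> set (v # X)"
      show "\<exists>dl Pl X' P' d'. (w, dl, Pl) \<in> L \<and> spath T w v X' P' d' \<and> set X' \<subseteq> set (v # X) \<and> dl + d' \<le> d + q"
      proof (cases "w = v")
        case True
        have "(v, d + q, j # P) \<in> L" "spath T v v [v] [] 0" "d + q + 0 \<le> d + q"
          by (auto simp: L intro: spath.Nil)
        then show ?thesis using True by (metis list.set_intros(1) empty_subsetI insert_subset list.set(1,2))
      next
        case False
        then obtain dl Pl X' P' d' where *: "(w, dl, Pl) \<in> set S" "spath T w u X' P' d'" "set X' \<subseteq> set X" "dl + d' \<le> d"
          using w seg by auto
        \<comment> \<open>The clause \<open>set X' \<subseteq> set X\<close> of the invariant is
          used here: it keeps \<open>v\<close> off \<open>X'\<close>, so the extended segment is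
          again simple.\<close>
        have "spath T w v (v # X') (j # P') (d' + q)"
          using * v a a' by (auto intro: spath.Cons)
        moreover have "dl + (d' + q) \<le> d + q" using *(4) by (simp add: add.assoc[symmetric])
        moreover have "set (v # X') \<subseteq> set (v # X)" "(w, dl, Pl) \<in> L" using * L by auto
        ultimately show ?thesis by blast
      qed
    qed
    have old: "\<exists>X. spath T s v' X P' d' \<and>
       (\<forall>w\<in>set X. \<exists>dl Pl X'' P'' d''. (w, dl, Pl) \<in> L \<and> spath T w v' X'' P'' d'' \<and> set X'' \<subseteq> set X \<and> dl + d'' \<le> d')"
      if "(v', d', P') \<in> set S" for v' d' P'
      using ok that unfolding labels_ok_def L by (meson insertI2)
    show ?thesis unfolding labels_ok_def L_def[symmetric]
    proof (intro allI impI)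
      fix v' d' P' assume "(v', d', P') \<in> L"
      then consider "v' = v" "d' = d + q" "P' = j # P" | "(v', d', P') \<in> set S" using L by auto
      then show "\<exists>X. spath T s v' X P' d' \<and>
         (\<forall>w\<in>set X. \<exists>dl Pl X'' P'' d''. (w, dl, Pl) \<in> L \<and> spath T w v' X'' P'' d'' \<and> set X'' \<subseteq> set X \<and> dl + d'' \<le> d')"
        by cases (use new old in simp_all)
    qed
  qed (use ok in simp)
qed

lemma relax_le:
  assumes S: "newest_best S" and l: "(u, d, P) \<in> set S"
  obtains d' P' where "(v, d', P') \<in> set (relax S (j, u, v, q))" "d' \<le> d + q"
proof -
  obtain l where l: "find (\<lambda>l. fst l = u) S = Some l" "fst (snd l) \<le> d"
    using newest_best_find[OF S l] by (metis fst_conv snd_conv)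
  show thesis
  proof (cases "\<exists>l'\<in>set S. fst l' = v \<and> \<not> fst (snd l) + q < fst (snd l')")
    case True
    then obtain d' P' where "(v, d', P') \<in> set S" "d' \<le> fst (snd l) + q" by force
    moreover have "fst (snd l) + q \<le> d + q" using l by simp
    ultimately show thesis using that relax_mono by (meson order.trans subsetD)
  next
    case False
    then have "(v, fst (snd l) + q, j # snd (snd l)) \<in> set (relax S (j, u, v, q))"
      using l by (auto simp: relax_def)
    then show thesis using that l by (meson add_right_mono)
  qed
qed

lemma foldl_relax_mono: "set S \<subseteq> set (foldl relax S As)"
  by (induction As arbitrary: S) (use relax_mono in \<open>auto, blast\<close>)

lemma foldl_relax_newest_best: "newest_best S \<Longrightarrow> newest_best (foldl relax S As)"
  by (induction As arbitrary: S) (auto intro: relax_newest_best)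

lemma foldl_relax_ok:
  "labels_ok T s (set S) \<Longrightarrow> set As \<subseteq> T \<Longrightarrow> nonneg_cycles T \<Longrightarrow> labels_ok T s (set (foldl relax S As))"
  by (induction As arbitrary: S) (auto intro: relax_ok)

text \<open>Relaxing other arcs before this one only adds labels, and relaxing others afterwards
  removes none. Hence the order of the arcs within a round does not matter.\<close>

lemma foldl_relax_le:
  assumes "newest_best S" and "(u, d, P) \<in> set S" and "(j, u, v, q) \<in> set As"
  obtains d' P' where "(v, d', P') \<in> set (foldl relax S As)" "d' \<le> d + q"
proof -
  obtain Bs Cs where As: "As = Bs @ (j, u, v, q) # Cs" using assms(3) by (meson split_list)
  have "(u, d, P) \<in> set (foldl relax S Bs)" using assms(2) foldl_relax_mono by blast
  then obtain d' P' where "(v, d', P') \<in> set (relax (foldl relax S Bs) (j, u, v, q))" "d' \<le> d + q"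
    using relax_le[OF foldl_relax_newest_best[OF assms(1)]] by metis
  then show thesis using that foldl_relax_mono[of "relax (foldl relax S Bs) (j, u, v, q)" Cs] As by auto
qed

lemma rounds_newest_best: "newest_best S \<Longrightarrow> newest_best (foldl (\<lambda>S _. foldl relax S As) S Bs)"
  by (induction Bs arbitrary: S) (auto intro: foldl_relax_newest_best)

lemma rounds_ok:
  "labels_ok T s (set S) \<Longrightarrow> set As \<subseteq> T \<Longrightarrow> nonneg_cycles T \<Longrightarrow>
    labels_ok T s (set (foldl (\<lambda>S _. foldl relax S As) S Bs))"
  by (induction Bs arbitrary: S) (auto intro: foldl_relax_ok)

lemma rounds_mono: "set S \<subseteq> set (foldl (\<lambda>S _. foldl relax S As) S Bs)"
  by (induction Bs arbitrary: S) (use foldl_relax_mono in \<open>auto, blast\<close>)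

lemma rounds_le:
  assumes "spath (set As) s v X P d" and "newest_best S" and "(s, 0, []) \<in> set S" and "length P \<le> length Bs"
  shows "\<exists>d' P'. (v, d', P') \<in> set (foldl (\<lambda>S _. foldl relax S As) S Bs) \<and> d' \<le> d"
  using assms
proof (induction arbitrary: Bs rule: spath.induct)
  case Nil
  then show ?case using rounds_mono by fastforce
next
  case (Cons v X P d j w q)
  \<comment> \<open>The last round takes care of the last arc of the path, the rounds in
    \<open>Cs\<close> of all earlier ones.\<close>
  obtain b Cs where Bs: "Bs = Cs @ [b]" using Cons.prems(3) by (cases Bs rule: rev_cases) auto
  obtain d' P' where d': "(v, d', P') \<in> set (foldl (\<lambda>S _. foldl relax S As) S Cs)" "d' \<le> d"
    using Cons.IH[of Cs] Cons.prems Bs by auto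
  obtain d'' P'' where "(w, d'', P'') \<in> set (foldl relax (foldl (\<lambda>S _. foldl relax S As) S Cs) As)" "d'' \<le> d' + q"
    using foldl_relax_le[OF rounds_newest_best[OF Cons.prems(1)] d'(1) Cons.hyps(2)] by blast
  moreover have "d' + q \<le> d + q" using d'(2) by simp
  ultimately show ?case using Bs by (auto intro: order.trans)
qed

text \<open>Every vertex of the path other than \<open>s\<close> is the head of some arc, so there
  are at most \<open>Suc (length As)\<close> vertices. This justifies the number of rounds.\<close>

lemma spath_length_le:
  assumes "spath (set As) s v X P d"
  shows "length P \<le> length As"
proof -
  have "set X \<subseteq> insert s ((\<lambda>a. fst (snd (snd a))) ` set As)"
    using assms by induction force+
  then have "card (set X) \<le> card (insert s ((\<lambda>a. fst (snd (snd a))) ` set As))"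
    by (intro card_mono) auto
  also have "\<dots> \<le> Suc (card ((\<lambda>a. fst (snd (snd a))) ` set As))" by (simp add: card_insert_if)
  also have "\<dots> \<le> Suc (length As)" by (meson Suc_le_mono card_image_le card_length finite_set order.trans)
  finally show ?thesis using spath_length[OF assms] by (simp add: distinct_card)
qed

lemma shortest_correct:
  assumes "nonneg_cycles (set As)"
  shows "case shortest s t As of
     None \<Rightarrow> \<not> (\<exists>X P d. spath (set As) s t X P d)
   | Some l \<Rightarrow> (\<exists>X. spath (set As) s t X (snd (snd l)) (fst (snd l))) \<and>
       (\<forall>X P d. spath (set As) s t X P d \<longrightarrow> fst (snd l) \<le> d)"
proof -
  have nb: "newest_best (bellman_ford s As)"
    unfolding bellman_ford_def by (rule rounds_newest_best) (simp add: newest_best_def)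
  have ok: "labels_ok (set As) s (set (bellman_ford s As))"
    unfolding bellman_ford_def
  proof (rule rounds_ok)
    show "labels_ok (set As) s (set [(s, 0, [])])"
      unfolding labels_ok_def by (force intro: spath.Nil)
  qed (use assms in auto)
  have le: "\<exists>d' P'. (t, d', P') \<in> set (bellman_ford s As) \<and> d' \<le> d" if "spath (set As) s t X P d" for X P d
    unfolding bellman_ford_def using that spath_length_le[OF that]
    by (intro rounds_le) (auto simp: newest_best_def)
  show ?thesis
  proof (cases "shortest s t As")
    case None
    then have "(t, d, P) \<notin> set (bellman_ford s As)" for d P
      by (force simp: shortest_def find_None_iff)
    then show ?thesis using None le by auto
  next
    case (Some l)
    then have l: "l \<in> set (bellman_ford s As)" "fst l = t"
      by (auto simp: shortest_def find_Some_iff)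
    have "fst (snd l) \<le> d" if sp: "spath (set As) s t X P d" for X P d
    proof -
      obtain d' P' where d': "(t, d', P') \<in> set (bellman_ford s As)" "d' \<le> d" using le[OF sp] by blast
      obtain l' where "find (\<lambda>l. fst l = t) (bellman_ford s As) = Some l'" "fst (snd l') \<le> d'"
        using newest_best_find[OF nb d'(1)] by (metis fst_conv snd_conv)
      then show ?thesis using Some d'(2) by (auto simp: shortest_def)
    qed
    moreover have "\<exists>X. spath (set As) s t X (snd (snd l)) (fst (snd l))"
      using ok l unfolding labels_ok_def by (metis prod.collapse)
    ultimately show ?thesis using Some by auto
  qed
qed

section \<open>Families of path sets\<close>

text \<open>The end pair is unordered because both orientations of an undirected edge carry the same
  name.\<close>

definition consistent :: "('i \<times> 'v \<times> 'v \<times> 'n::linordered_idom) set \<Rightarrow> bool" where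
  "consistent T \<longleftrightarrow> (\<forall>j u v q u' v' q'. (j, u, v, q) \<in> T \<longrightarrow> (j, u', v', q') \<in> T \<longrightarrow> {u, v} = {u', v'})"

definition path_sets :: "('i \<times> 'v \<times> 'v \<times> 'n::linordered_idom) set \<Rightarrow> 'v \<Rightarrow> 'v \<Rightarrow> 'i set set" where
  "path_sets T s t = {set P | X P d. spath T s t X P d}"

lemma spath_arc:
  "spath T u v X P d \<Longrightarrow> j \<in> set P \<Longrightarrow> \<exists>x y q. (j, x, y, q) \<in> T \<and> x \<in> set X \<and> y \<in> set X"
proof (induction rule: spath.induct)
  case (Cons v X P d i w q)
  show ?case
  proof (cases "j = i")
    case True
    then have "(j, v, w, q) \<in> T \<and> v \<in> set (w # X) \<and> w \<in> set (w # X)"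
      using Cons spath_ends[OF Cons.hyps(1)] by auto
    then show ?thesis by blast
  qed (use Cons in force)
qed simp

lemma spath_arc_ends:
  assumes "spath T u v X P d" "j \<in> set P" "consistent T" "(j, x, y, q) \<in> T"
  shows "x \<in> set X \<and> y \<in> set X"
proof -
  obtain x' y' q' where *: "(j, x', y', q') \<in> T" "x' \<in> set X" "y' \<in> set X" using spath_arc[OF assms(1,2)] by blast
  have "{x, y} = {x', y'}" using assms(3,4) *(1) unfolding consistent_def by blast
  then show ?thesis using * by (metis insert_iff singletonD)
qed

text \<open>A repeated name would have both ends among the vertices already visited, but the head of
  the new arc is a fresh vertex. With this the cost of a path becomes a sum over its arc
  set.\<close>

lemma spath_distinct: "spath T u v X P d \<Longrightarrow> consistent T \<Longrightarrow> distinct P"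
proof (induction rule: spath.induct)
  case (Cons v X P d j w q)
  then show ?case using spath_arc_ends[OF Cons.hyps(1), of j v w q] by auto
qed simp

lemma spath_cost:
  "spath T u v X P d \<Longrightarrow> (\<And>j x y q. (j, x, y, q) \<in> T \<Longrightarrow> q = c j) \<Longrightarrow> d = sum_list (map c P)"
  by (induction rule: spath.induct) (auto simp: add.commute)

lemma spath_cost_sum:
  assumes "spath T u v X P d" "consistent T" "\<And>j x y q. (j, x, y, q) \<in> T \<Longrightarrow> q = c j"
  shows "d = sum c (set P)"
  using spath_cost[OF assms(1,3)] spath_distinct[OF assms(1,2)] by (simp add: sum_list_distinct_conv_sum_set)

text \<open>Removing an arc of a path disconnects its ends.\<close>

lemma spath_cut:
  assumes "spath T s t X P d" "j \<in> set P" "consistent T"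
  shows "\<exists>Y. Y \<subseteq> set X \<and> s \<in> Y \<and> t \<notin> Y \<and>
    (\<forall>i x y q. i \<in> set P - {j} \<longrightarrow> (i, x, y, q) \<in> T \<longrightarrow> (x \<in> Y \<longleftrightarrow> y \<in> Y))"
  using assms
proof (induction rule: spath.induct)
  case (Cons v X P d i w q)
  show ?case
  proof (cases "j = i")
    case True
    \<comment> \<open>If the last arc is removed, the vertices before it form the cut: every other
      arc of the path has both ends among them.\<close>
    have "x \<in> set X \<longleftrightarrow> y \<in> set X" if "i' \<in> set (i # P) - {j}" "(i', x, y, q') \<in> T" for i' x y q'
      using spath_arc_ends[OF Cons.hyps(1) _ Cons.prems(2) that(2)] that(1) True by auto
    then show ?thesis using Cons.hyps(3) spath_ends[OF Cons.hyps(1)] by (intro exI[of _ "set X"]) auto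
  next
    case False
    then obtain Y where Y: "Y \<subseteq> set X" "s \<in> Y" "v \<notin> Y"
      "\<forall>i x y q. i \<in> set P - {j} \<longrightarrow> (i, x, y, q) \<in> T \<longrightarrow> (x \<in> Y \<longleftrightarrow> y \<in> Y)"
      using Cons.IH Cons.prems by auto
    \<comment> \<open>The last arc joins \<open>v\<close> and \<open>w\<close>, and both lie outside
      \<open>Y\<close>, so the cut of the shorter path still works.\<close>
    have "x \<in> Y \<longleftrightarrow> y \<in> Y" if "(i, x, y, q') \<in> T" for x y q'
    proof -
      have "{x, y} = {v, w}" using Cons.prems(2) that Cons.hyps(2) unfolding consistent_def by blast
      then show ?thesis using Y Cons.hyps(3) by (metis insert_iff singletonD subsetD)
    qed
    then have "x \<in> Y \<longleftrightarrow> y \<in> Y" if "i' \<in> set (i # P) - {j}" "(i', x, y, q') \<in> T" for i' x y q'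
      using that Y(4) by (cases "i' = i") (simp, force)
    moreover have "Y \<subseteq> set (w # X)" "w \<notin> Y" using Y(1) Cons.hyps(3) by auto
    ultimately show ?thesis using Y(2) by (intro exI[of _ Y]) blast
  qed
qed simp

text \<open>If \<open>p'\<close> had a further arc \<open>j\<close>, then \<open>p\<close> would be
  contained in \<open>p' - {j}\<close>. No arc of that set crosses the cut provided by
  \<open>spath_cut\<close>, so \<open>p\<close> could not lead from \<open>s\<close> to
  \<open>t\<close>.\<close>

lemma path_sets_antichain:
  assumes T: "consistent T" and "p \<in> path_sets T s t" "p' \<in> path_sets T s t" "p \<subseteq> p'"
  shows "p = p'"
proof (rule ccontr)
  assume "p \<noteq> p'"
  then obtain j where j: "j \<in> p'" "j \<notin> p" using assms(4) by blast
  obtain X P d X' P' d' where P: "spath T s t X P d" "p = set P" and P': "spath T s t X' P' d'" "p' = set P'"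
    using assms(2,3) by (auto simp: path_sets_def)
  obtain Y where Y: "s \<in> Y" "t \<notin> Y"
      "\<forall>i x y q. i \<in> set P' - {j} \<longrightarrow> (i, x, y, q) \<in> T \<longrightarrow> (x \<in> Y \<longleftrightarrow> y \<in> Y)"
    using spath_cut[OF P'(1) _ T, of j] j P' by blast
  have "set P \<subseteq> set P' - {j}" using j assms(4) P P' by blast
  with P(1) have "t \<in> Y"
    by induction (use Y in auto)
  then show False using Y by blast
qed

lemma path_sets_nonempty: "s \<noteq> t \<Longrightarrow> p \<in> path_sets T s t \<Longrightarrow> p \<noteq> {}"
  by (auto simp: path_sets_def elim: spath.cases)

section \<open>Path sets of digraphs and of undirected graphs\<close>

lemma (in wf_digraph) awalk_spath:
  assumes "spath T s v X P d" and T: "T = (\<lambda>j. (j, tail G j, head G j, c j)) ` arcs G" and s: "s \<in> verts G"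
  shows "awalk s (rev P) v \<and> awalk_verts s (rev P) = rev X"
  using assms(1)
proof induction
  case Nil
  then show ?case using s by (simp add: awalk_simps)
next
  case (Cons v X P d j w q)
  have j: "j \<in> arcs G" "v = tail G j" "w = head G j" using Cons.hyps(2) by (auto simp: T)
  have "awalk s (rev P @ [j]) w"
  proof (rule awalk_appendI)
    show "awalk s (rev P) v" using Cons.IH by blast
    show "awalk v [j] w" using j by (auto simp: awalk_simps)
  qed
  from awalk_verts_append[OF this] this show ?case using Cons.IH j by auto
qed

lemma (in wf_digraph) path_sets_directed:
  assumes T: "T = (\<lambda>j. (j, tail G j, head G j, c j)) ` arcs G" and s: "s \<in> verts G"
  shows "path_sets T s t = {set p | p. apath s p t}"
proof -
  have "\<exists>X d. spath T s v X (rev p) d \<and> set X = set (awalk_verts s p)" if "apath s p v" for p v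
    using that
  proof (induction p arbitrary: v rule: rev_induct)
    case Nil
    then show ?case by (auto simp: apath_simps intro: spath.Nil intro!: exI[of _ "[v]"])
  next
    case (snoc j p)
    then have w: "awalk s p (tail G j)" "j \<in> arcs G" "v = head G j"
      by (auto simp: apath_def awalk_simps)
    then have v: "awalk_verts s (p @ [j]) = awalk_verts s p @ [v]"
      using snoc.prems by (auto simp: apath_def awalk_verts_append)
    then have "apath s p (tail G j)" using w snoc.prems by (auto simp: apath_def)
    then obtain X d where X: "spath T s (tail G j) X (rev p) d" "set X = set (awalk_verts s p)"
      using snoc.IH by blast
    have "v \<notin> set X" using v snoc.prems X by (auto simp: apath_def)
    then have "spath T s v (v # X) (j # rev p) (d + c j)"
      using X w by (intro spath.Cons) (auto simp: T)
    then show ?case using X v by (intro exI[of _ "v # X"] exI[of _ "d + c j"]) auto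
  qed
  then have "\<exists>X P d. spath T s t X P d \<and> set P = set p" if "apath s p t" for p
    using that by (metis set_rev)
  moreover have "apath s (rev P) t" if "spath T s t X P d" for X P d
    using awalk_spath[OF that T s] spath_length[OF that] by (simp add: apath_def)
  ultimately show ?thesis unfolding path_sets_def by (auto, metis set_rev, metis)
qed

lemma (in wf_digraph) nonneg_cycles_directed:
  assumes T: "T = (\<lambda>j. (j, tail G j, head G j, c j)) ` arcs G" and c: "conservative G c"
  shows "nonneg_cycles T"
  unfolding nonneg_cycles_def
proof (intro allI impI)
  fix u v X P d j q
  assume sp: "spath T u v X P d" and j: "(j, v, u, q) \<in> T"
  then have u: "u \<in> verts G" by (auto simp: T)
  note * = awalk_spath[OF _ T u]
  have "awalk u (rev P @ [j]) u" 
  proof (rule awalk_appendI)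
    show "awalk u (rev P) v" using *[OF sp] by blast
    show "awalk v [j] u" using j by (auto simp: T awalk_simps)
  qed
  note w = this
  from w have w2: "awalk_verts u (rev P @ [j]) = awalk_verts u (rev P) @ [u]"
    using j by (auto simp: awalk_verts_append T)
  have "hd (rev X) = u" "distinct (rev X)" "X \<noteq> []"
    using *[OF sp] spath_length[OF sp] by (metis awhd_of_awalk, auto)
  then obtain Y where "rev X = u # Y" "distinct (u # Y)" by (metis hd_Cons_tl rev_is_Nil_conv)
  \<comment> \<open>The closed walk visits \<open>u # Y @ [u]\<close>; dropping the first
    \<open>u\<close> leaves a rearrangement of the distinct list \<open>u # Y\<close>.\<close>
  then have "distinct (tl (awalk_verts u (rev P @ [j])))" using *[OF sp] w2 by simp
  then have "cycle (rev P @ [j])" using w unfolding cycle_def by blast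
  then have "0 \<le> sum_list (map c (rev P @ [j]))" using c unfolding conservative_def by blast
  moreover have "d = sum_list (map c P)" by (rule spath_cost[OF sp]) (auto simp: T)
  ultimately show "0 \<le> d + q" using j by (auto simp: T sum_list_rev rev_map[symmetric])
qed

text \<open>As \<open>{u, v}\<close> is unordered, the assumption on \<open>T\<close> supplies both
  orientations of every edge, so each edge of an undirected path is available in the direction of
  traversal.\<close>

lemma path_sets_undirected:
  assumes T: "\<And>j u v q. (j, u, v, q) \<in> T \<longleftrightarrow> j \<in> uedges G \<and> uends G j = {u, v} \<and> q = c j"
    and G: "fin_ugraph G" and s: "s \<in> uverts G"
  shows "path_sets T s t = {set p | p. upath G s p t}"
proof -
  have "length X = Suc (length P) \<and> distinct X \<and> set X \<subseteq> uverts G \<and> set P \<subseteq> uedges G \<and> hd X = v \<and> last X = s \<and>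
     (\<forall>i<length P. uends G (rev P ! i) = {rev X ! i, rev X ! Suc i})" if "spath T s v X P d" for v X P d
    using that
  proof induction
    case (Cons v X P d j w q)
    have "w \<in> uverts G" using Cons.hyps(2) G T unfolding fin_ugraph_def by (metis insert_iff singletonD)
    moreover have "uends G (rev (j # P) ! i) = {rev (w # X) ! i, rev (w # X) ! Suc i}" if "i < length (j # P)" for i
    proof (cases "i < length P")
      case False
      then have i: "i = length P" using that by simp
      have "rev X ! length P = v" using Cons.IH by (cases X) (auto simp: nth_append)
      then show ?thesis using Cons.IH Cons.hyps(2) i by (simp add: nth_append T)
    qed (use Cons.IH in \<open>simp add: nth_append\<close>)
    ultimately show ?case using Cons by (auto simp: T)
  qed (use s in auto)
  then have 1: "spath T s t X P d \<Longrightarrow> upath G s (rev P) t" for X P d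
    unfolding upath_def by (intro exI[of _ "rev X"]) (force simp: hd_rev last_rev)
  have 2: "\<exists>X d. spath T s t X (rev p) d" if p: "upath G s p t" for p
  proof -
    obtain vs where vs: "length vs = Suc (length p)" "set p \<subseteq> uedges G" "distinct vs" "hd vs = s" "last vs = t"
      "\<forall>i < length p. uends G (p ! i) = {vs ! i, vs ! Suc i}"
      using p unfolding upath_def by blast
    \<comment> \<open>Induction over prefixes: \<open>n\<close> edges come with \<open>Suc n\<close>
      vertices, and \<open>spath\<close> lists both backwards.\<close>
    have "\<exists>d. spath T s (vs ! n) (rev (take (Suc n) vs)) (rev (take n p)) d" if "n \<le> length p" for n
      using that
    proof (induction n)
      case 0
      have "vs ! 0 = s" "take (Suc 0) vs = [s]" using vs(1,4) by (cases vs; auto)+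
      then show ?case by (auto intro: spath.Nil)
    next
      case (Suc n)
      then obtain d where d: "spath T s (vs ! n) (rev (take (Suc n) vs)) (rev (take n p)) d" by auto
      have t: "take (Suc (Suc n)) vs = take (Suc n) vs @ [vs ! Suc n]" "take (Suc n) p = take n p @ [p ! n]"
        using Suc.prems vs(1) by (simp_all add: take_Suc_conv_app_nth)
      have "distinct (take (Suc (Suc n)) vs)" using vs(3) by simp
      then have "vs ! Suc n \<notin> set (rev (take (Suc n) vs))" unfolding t(1) by simp
      moreover have "(p ! n, vs ! n, vs ! Suc n, c (p ! n)) \<in> T" using vs Suc.prems by (auto simp: T)
      ultimately show ?case using spath.Cons[OF d] t by auto
    qed
    from this[of "length p"] vs(1,5) show ?thesis by (metis diff_Suc_1 last_conv_nth le_refl length_0_conv nat.distinct(1) take_all)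
  qed
  show ?thesis
  proof (intro equalityI subsetI)
    fix p assume "p \<in> path_sets T s t"
    then obtain X P d where "spath T s t X P d" "p = set P" unfolding path_sets_def by blast
    then have "p = set (rev P)" "upath G s (rev P) t" using 1 by auto
    then show "p \<in> {set p | p. upath G s p t}" by blast
  next
    fix p' assume "p' \<in> {set p | p. upath G s p t}"
    then obtain p where p: "p' = set (rev p)" "upath G s p t" by auto
    then obtain X d where "spath T s t X (rev p) d" using 2 by blast
    with p(1) show "p' \<in> path_sets T s t" unfolding path_sets_def by blast
  qed
qed

section \<open>Minimal color classes\<close>

definition minimal_sets :: "'a set set \<Rightarrow> 'a set set" where
  "minimal_sets F = {M \<in> F. \<forall>C\<in>F. C \<subseteq> M \<longrightarrow> M \<subseteq> C}"

lemma minimal_sets_below: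
  assumes "finite F" and "C \<in> F"
  obtains M where "M \<in> minimal_sets F" "M \<subseteq> C"
  using finite_has_minimal2[OF assms] unfolding minimal_sets_def by auto

lemma minimal_sets_disjoint:
  assumes "laminar F" and "M \<in> minimal_sets F" and "M' \<in> minimal_sets F" and "M \<noteq> M'"
  shows "M \<inter> M' = {}"
proof (rule ccontr)
  assume "M \<inter> M' \<noteq> {}"
  moreover have F: "M \<in> F" "M' \<in> F" using assms by (auto simp: minimal_sets_def)
  ultimately have "M \<subseteq> M' \<or> M' \<subseteq> M" using assms(1) unfolding laminar_def by metis
  then show False using assms(2-4) F by (auto simp: minimal_sets_def)
qed

lemma sum_minimal_sets:
  assumes "finite F" "laminar F" "\<And>M. M \<in> minimal_sets F \<Longrightarrow> finite (B M) \<and> B M \<subseteq> M"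
  shows "sum c (\<Union>M\<in>minimal_sets F. B M) = (\<Sum>M\<in>minimal_sets F. sum c (B M))"
proof (rule sum.UNION_disjoint)
  show "finite (minimal_sets F)" using assms(1) by (simp add: minimal_sets_def)
  show "\<forall>M\<in>minimal_sets F. \<forall>M'\<in>minimal_sets F. M \<noteq> M' \<longrightarrow> B M \<inter> B M' = {}"
    using minimal_sets_disjoint[OF assms(2)] assms(3) by blast
qed (use assms(3) in blast)

text \<open>Paths appear only as an abstract family \<open>\<P>\<close>: being a nonempty antichain
  member is all that the combinatorial argument asks of an s-t path, so directed and undirected
  problems are treated together.\<close>

locale laminar_paths =
  fixes E :: "'a set" and F :: "'a set set" and \<P> :: "'a set set" and c :: "'a \<Rightarrow> 'n::linordered_idom"
  assumes finite_E: "finite E" and finite_F: "finite F" and laminar: "laminar F" and Union_F: "\<Union>F = E"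
    and antichain: "p \<in> \<P> \<Longrightarrow> p' \<in> \<P> \<Longrightarrow> p \<subseteq> p' \<Longrightarrow> p = p'" and nonempty: "{} \<notin> \<P>"
begin

lemma minimal_subset: "M \<in> minimal_sets F \<Longrightarrow> M \<subseteq> E"
  using Union_F by (auto simp: minimal_sets_def)

definition exact :: "'a set \<Rightarrow> bool" where
  "exact X \<longleftrightarrow> X \<subseteq> E \<and> (\<forall>C\<in>F. X \<inter> C \<in> \<P>)"

definition superset :: "'a set \<Rightarrow> bool" where
  "superset X \<longleftrightarrow> X \<subseteq> E \<and> (\<forall>C\<in>F. \<exists>p\<in>\<P>. p \<subseteq> X \<inter> C)"

lemma exact_imp_superset: "exact X \<Longrightarrow> superset X"
  by (auto simp: exact_def superset_def)

lemma superset_minimal: "superset X \<Longrightarrow> M \<in> minimal_sets F \<Longrightarrow> \<exists>p\<in>\<P>. p \<subseteq> X \<inter> M"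
  by (auto simp: superset_def minimal_sets_def)

lemma exact_Int_eq:
  assumes "exact X" "M \<in> F" "C \<in> F" "M \<subseteq> C"
  shows "X \<inter> M = X \<inter> C"
  using assms antichain[of "X \<inter> M" "X \<inter> C"] by (auto simp: exact_def)

lemma exact_unique:
  assumes X: "exact X" and C: "C \<in> F" and M: "M \<in> minimal_sets F" "M \<subseteq> C" and M': "M' \<in> minimal_sets F" "M' \<subseteq> C"
  shows "M = M'"
proof (rule ccontr)
  assume "M \<noteq> M'"
  then have "M \<inter> M' = {}" using minimal_sets_disjoint[OF laminar] M M' by blast
  moreover have "M \<in> F" "M' \<in> F" using M M' by (auto simp: minimal_sets_def)
  \<comment> \<open>Both sides equal \<open>X \<inter> C\<close>. Since \<open>M\<close> and
    \<open>M'\<close> are disjoint, this common path would be empty.\<close>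
  moreover from this have "X \<inter> M = X \<inter> M'" using exact_Int_eq[OF X _ C] M M' by metis
  ultimately show False using X nonempty unfolding exact_def by (metis Int_absorb Int_assoc Int_commute Int_empty_right)
qed

lemma exact_decompose:
  assumes "exact X"
  shows "X = (\<Union>M\<in>minimal_sets F. X \<inter> M)"
proof -
  have "x \<in> (\<Union>M\<in>minimal_sets F. X \<inter> M)" if x: "x \<in> X" for x
  proof -
    obtain C where C: "C \<in> F" "x \<in> C" using x assms Union_F by (auto simp: exact_def)
    obtain M where M: "M \<in> minimal_sets F" "M \<subseteq> C" using minimal_sets_below[OF finite_F C(1)] .
    then show ?thesis using exact_Int_eq[OF assms _ C(1) M(2)] C x by (auto simp: minimal_sets_def)
  qed
  then show ?thesis by blast
qed

text \<open>A class \<open>C\<close> meets just one minimal class: by laminarity a minimal class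
  meeting \<open>C\<close> lies in \<open>C\<close>, where \<open>unique\<close> applies, or
  contains \<open>C\<close> and then equals it by minimality. So the union cut down to
  \<open>C\<close> is a single chosen path.\<close>

lemma exact_solution:
  assumes B: "\<And>M. M \<in> minimal_sets F \<Longrightarrow> B M \<in> \<P> \<and> B M \<subseteq> M"
    and unique: "\<And>C M M'. C \<in> F \<Longrightarrow> M \<in> minimal_sets F \<Longrightarrow> M' \<in> minimal_sets F \<Longrightarrow> M \<subseteq> C \<Longrightarrow> M' \<subseteq> C \<Longrightarrow> M = M'"
  shows "exact (\<Union>M\<in>minimal_sets F. B M)"
  unfolding exact_def
proof (intro conjI ballI)
  show "(\<Union>M\<in>minimal_sets F. B M) \<subseteq> E" using B minimal_subset by blast
  fix C assume C: "C \<in> F"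
  obtain M where M: "M \<in> minimal_sets F" "M \<subseteq> C" using minimal_sets_below[OF finite_F C] .
  have "M' = M" if M': "M' \<in> minimal_sets F" "M' \<inter> C \<noteq> {}" for M'
  proof -
    have "M' \<subseteq> C \<or> C \<subseteq> M'" using laminar C M' unfolding laminar_def minimal_sets_def by blast
    then show ?thesis
    proof
      assume "C \<subseteq> M'"
      then show ?thesis using M M' by (auto simp: minimal_sets_def)
    qed (use unique[OF C] M M' in blast)
  qed
  then have "(\<Union>M\<in>minimal_sets F. B M) \<inter> C = B M" using B M by blast
  then show "(\<Union>M\<in>minimal_sets F. B M) \<inter> C \<in> \<P>" using B M by simp
qed

lemma exact_optimal:
  assumes B: "\<And>M. M \<in> minimal_sets F \<Longrightarrow> B M \<in> \<P> \<and> B M \<subseteq> M"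
    and best: "\<And>M p. M \<in> minimal_sets F \<Longrightarrow> p \<in> \<P> \<Longrightarrow> p \<subseteq> M \<Longrightarrow> sum c (B M) \<le> sum c p"
    and X: "exact X"
  shows "sum c (\<Union>M\<in>minimal_sets F. B M) \<le> sum c X"
proof -
  have fin: "finite M" if "M \<in> minimal_sets F" for M using that minimal_subset finite_E finite_subset by blast
  have "sum c (\<Union>M\<in>minimal_sets F. B M) = (\<Sum>M\<in>minimal_sets F. sum c (B M))"
    using B fin by (intro sum_minimal_sets finite_F laminar) (meson finite_subset)
  \<comment> \<open>A minimal class is itself a color class, so \<open>X \<inter> M\<close> is one
    of the paths with which \<open>B M\<close> competes.\<close>
  also have "\<dots> \<le> (\<Sum>M\<in>minimal_sets F. sum c (X \<inter> M))"
    using X by (intro sum_mono best) (auto simp: exact_def minimal_sets_def)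
  also have "\<dots> = sum c (\<Union>M\<in>minimal_sets F. X \<inter> M)"
    using fin by (intro sum_minimal_sets[symmetric] finite_F laminar) blast
  finally show ?thesis using exact_decompose[OF X] by simp
qed

definition neg :: "'a set" where
  "neg = {j \<in> E. c j < 0}"

lemma superset_solution:
  assumes B: "\<And>M. M \<in> minimal_sets F \<Longrightarrow> B M \<in> \<P> \<and> B M \<subseteq> M"
  shows "superset ((\<Union>M\<in>minimal_sets F. B M) \<union> neg)"
  unfolding superset_def
proof (intro conjI ballI)
  show "(\<Union>M\<in>minimal_sets F. B M) \<union> neg \<subseteq> E" using B minimal_subset by (auto simp: neg_def)
  fix C assume C: "C \<in> F"
  obtain M where M: "M \<in> minimal_sets F" "M \<subseteq> C" using minimal_sets_below[OF finite_F C] .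
  then show "\<exists>p\<in>\<P>. p \<subseteq> ((\<Union>M\<in>minimal_sets F. B M) \<union> neg) \<inter> C" using B by blast
qed

text \<open>Negative arcs can be added for free, so that only the nonnegative parts of the costs matter for
  the choice of the paths.\<close>

lemma superset_optimal:
  assumes B: "\<And>M. M \<in> minimal_sets F \<Longrightarrow> B M \<in> \<P> \<and> B M \<subseteq> M"
    and best: "\<And>M p. M \<in> minimal_sets F \<Longrightarrow> p \<in> \<P> \<Longrightarrow> p \<subseteq> M \<Longrightarrow>
      (\<Sum>j\<in>B M. max (c j) 0) \<le> (\<Sum>j\<in>p. max (c j) 0)"
    and X: "superset X"
  shows "sum c ((\<Union>M\<in>minimal_sets F. B M) \<union> neg) \<le> sum c X"
proof -
  let ?U = "\<Union>M\<in>minimal_sets F. B M"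
  have fin: "finite M" if "M \<in> minimal_sets F" for M using that minimal_subset finite_E finite_subset by blast
  \<comment> \<open>Each cost is its nonnegative part plus a negative part that lives on
    \<open>neg\<close>; the two parts are compared separately.\<close>
  have split: "sum c A = (\<Sum>j\<in>A. max (c j) 0) + sum c (A \<inter> neg)" if "A \<subseteq> E" for A
  proof -
    have "finite A" using that finite_E finite_subset by blast
    have "sum c A = (\<Sum>j\<in>A. max (c j) 0 + (if j \<in> neg then c j else 0))"
      using that by (intro sum.cong) (auto simp: neg_def max_def not_le)
    then show ?thesis using \<open>finite A\<close> by (simp add: sum.distrib sum.inter_restrict)
  qed
  have X': "X \<subseteq> E" "finite X" using X finite_E by (auto simp: superset_def intro: finite_subset)
  have U: "?U \<subseteq> E" using B minimal_subset by blast
  have "sum c (?U \<union> neg) = (\<Sum>j\<in>?U \<union> neg. max (c j) 0) + sum c neg"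
    using U by (subst split) (auto simp: neg_def Int_absorb1 intro!: arg_cong[of _ _ "sum c"])
  also have "(\<Sum>j\<in>?U \<union> neg. max (c j) 0) = (\<Sum>j\<in>?U. max (c j) 0)"
    using U finite_E by (intro sum.mono_neutral_right) (auto simp: neg_def max_def intro: finite_subset)
  also have "\<dots> = (\<Sum>M\<in>minimal_sets F. \<Sum>j\<in>B M. max (c j) 0)"
    using B fin by (intro sum_minimal_sets finite_F laminar) (meson finite_subset)
  also have "\<dots> \<le> (\<Sum>M\<in>minimal_sets F. \<Sum>j\<in>X \<inter> M. max (c j) 0)"
  proof (rule sum_mono)
    fix M assume M: "M \<in> minimal_sets F"
    obtain p where p: "p \<in> \<P>" "p \<subseteq> X \<inter> M" using superset_minimal[OF X M] by blast
    then have "(\<Sum>j\<in>B M. max (c j) 0) \<le> (\<Sum>j\<in>p. max (c j) 0)" using best[OF M] by blast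
    also have "\<dots> \<le> (\<Sum>j\<in>X \<inter> M. max (c j) 0)" using p fin[OF M] by (intro sum_mono2) auto
    finally show "(\<Sum>j\<in>B M. max (c j) 0) \<le> (\<Sum>j\<in>X \<inter> M. max (c j) 0)" .
  qed
  also have "\<dots> = (\<Sum>j\<in>(\<Union>M\<in>minimal_sets F. X \<inter> M). max (c j) 0)"
    using fin by (intro sum_minimal_sets[symmetric] finite_F laminar) blast
  also have "\<dots> \<le> (\<Sum>j\<in>X. max (c j) 0)"
    using X' by (intro sum_mono2) auto
  \<comment> \<open>Negative elements missing from \<open>X\<close> could only lower its
    cost.\<close>
  also have "sum c neg \<le> sum c (X \<inter> neg)"
  proof -
    have "sum c neg = sum c (X \<inter> neg) + sum c (neg - X)"
      using finite_E by (subst sum.union_disjoint[symmetric]) (auto simp: neg_def intro!: arg_cong[of _ _ "sum c"])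
    moreover have "sum c (neg - X) \<le> 0" by (intro sum_nonpos) (auto simp: neg_def)
    ultimately show ?thesis by simp
  qed
  finally show ?thesis using split[OF X'(1)] by simp
qed

end

section \<open>The algorithm on graphs\<close>

definition table_arcs :: "'n::linordered_idom sim_input \<Rightarrow> (nat \<times> nat \<times> nat \<times> 'n) list" where
  "table_arcs I = map (\<lambda>j. (j, arc_table I ! j)) [0..<length (arc_table I)]"

definition arcs_of :: "bool \<Rightarrow> bool \<Rightarrow> 'n::linordered_idom sim_input \<Rightarrow> (nat \<times> nat \<times> nat \<times> 'n) list" where
  "arcs_of und super I =
     (let As = table_arcs I;
          Bs = (if und then As @ map (\<lambda>(j, u, v, q). (j, v, u, q)) As else As)
      in if super then map (\<lambda>(j, u, v, q). (j, u, v, if q < 0 then 0 else q)) Bs else Bs)"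

definition minimal_lists :: "'n sim_input \<Rightarrow> nat list list" where
  "minimal_lists I =
     filter (\<lambda>C. \<forall>C'\<in>set (color_lists I). set C' \<subseteq> set C \<longrightarrow> set C \<subseteq> set C') (color_lists I)"

definition class_path :: "bool \<Rightarrow> bool \<Rightarrow> 'n::linordered_idom sim_input \<Rightarrow> nat set \<Rightarrow> (nat \<times> 'n \<times> nat list) option" where
  "class_path und super I M =
     shortest (source I) (target I) (filter (\<lambda>a. fst a \<in> M) (arcs_of und super I))"

definition ambiguous :: "'n sim_input \<Rightarrow> bool" where
  "ambiguous I \<longleftrightarrow> (\<exists>C\<in>set (color_lists I). \<exists>M\<in>set (minimal_lists I). \<exists>M'\<in>set (minimal_lists I).
     set M \<subseteq> set C \<and> set M' \<subseteq> set C \<and> \<not> set M \<subseteq> set M')"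

text \<open>Counterpart of \<open>vmain\<close> on unencoded inputs. Its correctness is proved
  below, and \<open>vmain_enc\<close> transfers it to the program.\<close>

definition simultaneous :: "bool \<Rightarrow> bool \<Rightarrow> 'n::linordered_idom sim_input \<Rightarrow> nat list option" where
  "simultaneous und super I =
     (if (\<not> super \<and> ambiguous I) \<or> (\<exists>M\<in>set (minimal_lists I). class_path und super I (set M) = None) then None
      else Some (concat (map (\<lambda>M. snd (snd (the (class_path und super I (set M))))) (minimal_lists I)) @
        (if super then map fst (filter (\<lambda>a. snd (snd (snd a)) < 0) (table_arcs I)) else [])))"

lemma enc_nat_eq_iff [simp]: "enc_nat m = (enc_nat n :: 'n::linordered_idom val) \<longleftrightarrow> m = n"
  by (simp add: enc_nat_def)

fun enc_arc :: "nat \<times> nat \<times> nat \<times> 'n::linordered_idom \<Rightarrow> 'n val" where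
  "enc_arc (j, u, v, q) = enc_list [enc_nat j, enc_nat u, enc_nat v, Num q]"

fun enc_label :: "nat \<times> 'n::linordered_idom \<times> nat list \<Rightarrow> 'n val" where
  "enc_label (v, d, P) = Node (enc_nat v) (Node (Num d) (enc_list (map enc_nat P)))"

text \<open>The head of a filtered list replaces a search, with \<open>Leaf\<close> in the role of
  \<open>None\<close>. For labels this is unambiguous, as \<open>enc_label\<close> always yields a
  \<open>Node\<close>.\<close>

lemma left_enc_filter:
  "left (enc_list (filter Q (map f xs))) = (case find (\<lambda>x. Q (f x)) xs of None \<Rightarrow> Leaf | Some x \<Rightarrow> f x)"
  by (induction xs) auto

lemma enc_label_sel [simp]:
  "left (enc_label l) = enc_nat (fst l)" "left (right (enc_label l)) = Num (fst (snd l))"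
  "right (right (enc_label l)) = enc_list (map enc_nat (snd (snd l)))" "enc_label l \<noteq> Leaf"
  by (cases l; simp)+

lemma enc_arc_sel [simp]:
  "left (enc_arc a) = enc_nat (fst a)" "left (right (enc_arc a)) = enc_nat (fst (snd a))"
  "left (right (right (enc_arc a))) = enc_nat (fst (snd (snd a)))"
  "left (right (right (right (enc_arc a)))) = Num (snd (snd (snd a)))"
  by (cases a; simp)+

lemma filter_map_eq: "(\<And>x. Q (f x) = R x) \<Longrightarrow> filter Q (map f xs) = map f (filter R xs)"
  by (induction xs) auto

section \<open>Agreement of the program with its counterpart on lists\<close>

context cost_model
begin

lemma vrelax_enc:
  "vrelax (enc_list (map enc_label S)) (enc_arc a) = enc_list (map enc_label (relax S a))"
  by (cases a) (auto simp: vrelax_def relax_def Let_def left_enc_filter split: option.split)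

lemma foldl_vrelax_enc:
  "foldl vrelax (enc_list (map enc_label S)) (map enc_arc As) = enc_list (map enc_label (foldl relax S As))"
  by (induction As arbitrary: S) (simp_all add: vrelax_enc)

lemma vbf_enc: "vbf (enc_nat s) (map enc_arc As) = enc_list (map enc_label (bellman_ford s As))"
proof -
  have "foldl (\<lambda>S _. foldl vrelax S (map enc_arc As)) (enc_list (map enc_label S)) (map enc_arc Bs)
      = enc_list (map enc_label (foldl (\<lambda>S _. foldl relax S As) S Bs))" for S Bs
    by (induction Bs arbitrary: S) (simp_all add: foldl_vrelax_enc)
  from this[of "[(s, 0, [])]" As] show ?thesis by (simp add: vbf_def bellman_ford_def)
qed

lemma vshortest_enc:
  "vshortest (enc_nat s) (enc_nat t) (map enc_arc As) =
     (case shortest s t As of None \<Rightarrow> Leaf | Some l \<Rightarrow> enc_label l)"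
  by (simp add: vshortest_def shortest_def vbf_enc left_enc_filter)

lemma varcs_enc: "varcs und super (enc_input I) = map enc_arc (arcs_of und super I)"
proof -
  have t: "dec_list (left (right (enc_input I))) = map enc_arc (table_arcs I)"
    by (auto simp: enc_input_def table_arcs_def split: prod.split)
  show ?thesis
    unfolding varcs_def t arcs_of_def Let_def by (auto split: prod.split)
qed

lemma vsubset_enc: "vsubset (enc_list (map enc_nat C)) (enc_list (map enc_nat C')) \<longleftrightarrow> set C \<subseteq> set C'"
  by (auto simp: vsubset_def)

lemma color_lists_enc:
  "dec_list (left (right (right (enc_input I)))) = map (\<lambda>C. enc_list (map enc_nat C)) (color_lists I)"
  by (simp add: enc_input_def)

lemma vminimal_enc: "vminimal (enc_input I) = map (\<lambda>C. enc_list (map enc_nat C)) (minimal_lists I)"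
  unfolding vminimal_def minimal_lists_def color_lists_enc Let_def
  by (rule filter_map_eq) (simp add: vsubset_enc)

lemma vpaths_enc:
  "vpaths und super (enc_input I) = map (\<lambda>M. case class_path und super I (set M) of
     None \<Rightarrow> Leaf | Some l \<Rightarrow> enc_label l) (minimal_lists I)"
proof -
  have st: "left (right (right (right (enc_input I)))) = enc_nat (source I)"
    "left (right (right (right (right (enc_input I))))) = enc_nat (target I)"
    by (simp_all add: enc_input_def)
  have "filter (\<lambda>a. \<exists>e\<in>set (map enc_nat M). left a = e) (varcs und super (enc_input I)) =
      map enc_arc (filter (\<lambda>a. fst a \<in> set M) (arcs_of und super I))" for M
    unfolding varcs_enc by (rule filter_map_eq) auto
  then show ?thesis
    unfolding vpaths_def vminimal_enc st class_path_def by (simp add: vshortest_enc del: set_map)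
qed

lemma vmain_enc: "vmain und super (enc_input I) = enc_answer (simultaneous und super I)"
proof -
  have neg: "map left (filter (\<lambda>a. vless (left (right (right (right a)))) (Num 0)) (dec_list (left (right (enc_input I)))))
      = map enc_nat (map fst (filter (\<lambda>a. snd (snd (snd a)) < 0) (table_arcs I)))"
  proof -
    have t: "dec_list (left (right (enc_input I))) = map enc_arc (table_arcs I)"
      by (auto simp: enc_input_def table_arcs_def split: prod.split)
    show ?thesis unfolding t by (subst filter_map_eq[where R = "\<lambda>a. snd (snd (snd a)) < 0"]) auto
  qed
  have amb: "(\<exists>C\<in>set (dec_list (left (right (right (enc_input I))))). \<exists>M\<in>set (vminimal (enc_input I)).
      \<exists>M'\<in>set (vminimal (enc_input I)). vsubset M C \<and> vsubset M' C \<and> \<not> vsubset M M') \<longleftrightarrow> ambiguous I"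
    unfolding ambiguous_def color_lists_enc vminimal_enc by (simp add: vsubset_enc)
  have none: "(\<exists>l\<in>set (vpaths und super (enc_input I)). l = Leaf) \<longleftrightarrow>
      (\<exists>M\<in>set (minimal_lists I). class_path und super I (set M) = None)"
  proof -
    have "(case x of None \<Rightarrow> Leaf | Some l \<Rightarrow> enc_label l) = Leaf \<longleftrightarrow> x = None" for x :: "(nat \<times> 'n \<times> nat list) option"
      by (cases x) auto
    then show ?thesis unfolding vpaths_enc by (simp only: set_map bex_simps)
  qed
  have paths: "concat (map (\<lambda>l. dec_list (right (right l))) (vpaths und super (enc_input I))) =
      map enc_nat (concat (map (\<lambda>M. snd (snd (the (class_path und super I (set M))))) (minimal_lists I)))"
    if ok: "\<not> (\<exists>M\<in>set (minimal_lists I). class_path und super I (set M) = None)"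
    unfolding vpaths_enc map_concat map_map
  proof (intro arg_cong[of _ _ concat] map_cong refl)
    fix M assume "M \<in> set (minimal_lists I)"
    then obtain l where "class_path und super I (set M) = Some l" using ok by auto
    then show "((\<lambda>l. dec_list (right (right l))) \<circ> (\<lambda>M. case class_path und super I (set M) of
        None \<Rightarrow> Leaf | Some l \<Rightarrow> enc_label l)) M =
      (map enc_nat \<circ> (\<lambda>M. snd (snd (the (class_path und super I (set M)))))) M"
      by simp
  qed
  show ?thesis
  proof (cases "(\<not> super \<and> ambiguous I) \<or> (\<exists>M\<in>set (minimal_lists I). class_path und super I (set M) = None)")
    case True
    then show ?thesis unfolding vmain_def simultaneous_def amb none if_P[OF True] by (simp add: enc_answer_def)
  next
    case False
    then have *: "\<not> (\<exists>M\<in>set (minimal_lists I). class_path und super I (set M) = None)" by blast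
    show ?thesis
      unfolding vmain_def simultaneous_def amb none neg if_not_P[OF False] paths[OF *]
      by (simp add: enc_answer_def)
  qed
qed

lemma polytime_simultaneous:
  assumes "\<And>I. P I \<Longrightarrow> problem I (simultaneous und super I)"
  shows "polytime_solvable sz P problem"
  using polyfun_vmain[of und super] vmain_enc assms by (intro polytime_solvableI) blast+

end

section \<open>Correctness\<close>

lemma color_family_conv: "color_family I = set ` set (color_lists I)"
proof -
  have "set (color_lists I) = (!) (color_lists I) ` {..<length (color_lists I)}"
    by (auto simp: set_conv_nth)
  then show ?thesis by (simp add: color_family_def color_class_def num_colors_def image_image)
qed

lemma minimal_lists_conv: "set ` set (minimal_lists I) = minimal_sets (color_family I)"
  by (auto simp: minimal_lists_def minimal_sets_def color_family_conv)

lemma ambiguous_conv: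
  "ambiguous I \<longleftrightarrow> (\<exists>C\<in>color_family I. \<exists>M\<in>minimal_sets (color_family I). \<exists>M'\<in>minimal_sets (color_family I).
     M \<subseteq> C \<and> M' \<subseteq> C \<and> \<not> M \<subseteq> M')"
  unfolding ambiguous_def minimal_lists_conv[symmetric] unfolding color_family_conv by simp

lemma class_path_correct:
  fixes I :: "'n::linordered_idom sim_input"
  assumes T: "T = set (arcs_of und super I)" "consistent T" "nonneg_cycles T"
    and w: "\<And>j u v q. (j, u, v, q) \<in> T \<Longrightarrow> q = w j"
  shows "case class_path und super I M of
     None \<Rightarrow> \<not> (\<exists>p\<in>path_sets T (source I) (target I). p \<subseteq> M)
   | Some l \<Rightarrow> set (snd (snd l)) \<in> path_sets T (source I) (target I) \<and> set (snd (snd l)) \<subseteq> M \<and>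
       (\<forall>p\<in>path_sets T (source I) (target I). p \<subseteq> M \<longrightarrow> sum w (set (snd (snd l))) \<le> sum w p)"
proof -
  let ?As = "filter (\<lambda>a. fst a \<in> M) (arcs_of und super I)"
  have As: "set ?As = {a \<in> T. fst a \<in> M}" by (simp add: T(1))
  have "nonneg_cycles (set ?As)" unfolding As by (rule nonneg_cycles_subset[OF T(3)]) auto
  from shortest_correct[OF this, of "source I" "target I"]
  show ?thesis
    unfolding As spath_restrict class_path_def path_sets_def
    using spath_cost_sum[OF _ T(2) w]
    by (auto split: option.splits) (metis)+
qed

lemma set_simultaneous:
  assumes "simultaneous und super I = Some xs"
  shows "set xs = (\<Union>M\<in>minimal_sets (color_family I). set (snd (snd (the (class_path und super I M))))) \<union>
    (if super then {j. j < length (arc_table I) \<and> cost_of I j < 0} else {})"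
proof -
  have "set (map fst (filter (\<lambda>a. snd (snd (snd a)) < 0) (table_arcs I))) =
      {j. j < length (arc_table I) \<and> cost_of I j < 0}"
    by (force simp: table_arcs_def cost_of_def)
  then show ?thesis
    using assms unfolding simultaneous_def minimal_lists_conv[symmetric] by (auto split: if_splits)
qed

text \<open>Common setting of the four problems. The cost \<open>w\<close> guides the path search
  and is truncated at 0 for the superset problems, whereas the objective is always
  \<open>cost_of I\<close>.\<close>

locale sim_instance =
  fixes I :: "'n::linordered_idom sim_input" and und super :: bool and T :: "(nat \<times> nat \<times> nat \<times> 'n) set"
    and w :: "nat \<Rightarrow> 'n"
  assumes T: "T = set (arcs_of und super I)" "consistent T" "nonneg_cycles T"
    and w: "(j, u, v, q) \<in> T \<Longrightarrow> q = w j"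
    and w_def: "w = (if super then \<lambda>j. max (cost_of I j) 0 else cost_of I)"
    and laminar: "laminar (color_family I)" and Union: "\<Union>(color_family I) = {..<length (arc_table I)}"
    and st: "source I \<noteq> target I"
begin

abbreviation "\<P> \<equiv> path_sets T (source I) (target I)"

sublocale laminar_paths "{..<length (arc_table I)}" "color_family I" \<P> "cost_of I"
proof
  show "finite (color_family I)" by (simp add: color_family_conv)
  show "p \<in> \<P> \<Longrightarrow> p' \<in> \<P> \<Longrightarrow> p \<subseteq> p' \<Longrightarrow> p = p'" for p p' by (rule path_sets_antichain[OF T(2)])
  show "{} \<notin> \<P>" using path_sets_nonempty[OF st] by blast
qed (simp_all add: laminar Union)

abbreviation "best M \<equiv> set (snd (snd (the (class_path und super I M))))"

text \<open>Stated for supersets; via \<open>exact_imp_superset\<close> it serves the exact problems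
  too.\<close>

lemma no_path_infeasible:
  "class_path und super I M = None \<Longrightarrow> M \<in> minimal_sets (color_family I) \<Longrightarrow> \<not> superset X"
  using class_path_correct[OF T w, where M = M] superset_minimal[of X M] by fastforce

lemma best_path:
  assumes "simultaneous und super I = Some xs" "M \<in> minimal_sets (color_family I)"
  shows "best M \<in> \<P> \<and> best M \<subseteq> M" and "p \<in> \<P> \<Longrightarrow> p \<subseteq> M \<Longrightarrow> sum w (best M) \<le> sum w p"
proof -
  have "\<not> (\<exists>M\<in>minimal_sets (color_family I). class_path und super I M = None)"
    using assms(1) unfolding simultaneous_def minimal_lists_conv[symmetric] by (auto split: if_splits)
  then obtain l where l: "class_path und super I M = Some l" using assms(2) by auto
  then show "best M \<in> \<P> \<and> best M \<subseteq> M" "p \<in> \<P> \<Longrightarrow> p \<subseteq> M \<Longrightarrow> sum w (best M) \<le> sum w p"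
    using class_path_correct[OF T w, where M = M] by auto
qed

lemma solves_superset:
  assumes super
  shows "solves superset (cost_of I) (simultaneous und super I)"
proof (cases "simultaneous und super I")
  case None
  then obtain M where "M \<in> minimal_sets (color_family I)" "class_path und super I M = None"
    using assms unfolding simultaneous_def minimal_lists_conv[symmetric] by (auto split: if_splits)
  then show ?thesis using no_path_infeasible None by (auto simp: solves_def)
next
  case (Some xs)
  have xs: "set xs = (\<Union>M\<in>minimal_sets (color_family I). best M) \<union> neg"
    using set_simultaneous[OF Some] assms by (auto simp: neg_def)
  have "superset (set xs)" unfolding xs using best_path[OF Some] by (intro superset_solution)
  moreover have "sum (cost_of I) (set xs) \<le> sum (cost_of I) X" if "superset X" for X
    unfolding xs using best_path[OF Some] assms that by (intro superset_optimal) (auto simp: w_def)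
  ultimately show ?thesis by (simp add: solves_def Some)
qed

lemma solves_exact:
  assumes "\<not> super"
  shows "solves exact (cost_of I) (simultaneous und super I)"
proof (cases "simultaneous und super I")
  case None
  then consider "ambiguous I" | M where "M \<in> minimal_sets (color_family I)" "class_path und super I M = None"
    using assms unfolding simultaneous_def minimal_lists_conv[symmetric] by (auto split: if_splits)
  then have "\<not> exact X" for X
    by cases (use exact_unique[of X] in \<open>unfold ambiguous_conv, blast\<close>, use no_path_infeasible exact_imp_superset in blast)
  then show ?thesis using None by (simp add: solves_def)
next
  case (Some xs)
  have xs: "set xs = (\<Union>M\<in>minimal_sets (color_family I). best M)"
    using set_simultaneous[OF Some] assms by auto
  have "\<not> ambiguous I" using Some assms by (auto simp: simultaneous_def split: if_splits)
  then have unique: "M = M'" if "C \<in> color_family I" "M \<in> minimal_sets (color_family I)" "M' \<in> minimal_sets (color_family I)"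
    "M \<subseteq> C" "M' \<subseteq> C" for C M M'
    using that unfolding ambiguous_conv by blast
  have "exact (set xs)" unfolding xs using best_path[OF Some] unique by (intro exact_solution)
  moreover have "sum (cost_of I) (set xs) \<le> sum (cost_of I) X" if "exact X" for X
    unfolding xs using best_path[OF Some] assms that by (intro exact_optimal) (auto simp: w_def)
  ultimately show ?thesis by (simp add: solves_def Some)
qed

end

lemma arcs_of_iff:
  "(j, u, v, q) \<in> set (arcs_of und super I) \<longleftrightarrow> j < length (arc_table I) \<and>
     (\<exists>q'. (arc_table I ! j = (u, v, q') \<or> und \<and> arc_table I ! j = (v, u, q')) \<and>
       q = (if super then max q' 0 else q'))"
proof -
  have tab: "(j, u, v, q) \<in> set (table_arcs I) \<longleftrightarrow> j < length (arc_table I) \<and> arc_table I ! j = (u, v, q)"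
    for j u v q
    by (auto simp: table_arcs_def)
  have flip: "(j, u, v, q) \<in> (\<lambda>(j, u, v, q). (j, v, u, q)) ` S \<longleftrightarrow> (j, v, u, q) \<in> S"
    for j u v q and S :: "(nat \<times> nat \<times> nat \<times> 'a) set"
    by force
  have cost: "(j, u, v, q) \<in> (\<lambda>(j, u, v, q). (j, u, v, f q)) ` S \<longleftrightarrow> (\<exists>q'. (j, u, v, q') \<in> S \<and> q = f q')"
    for j u v q and f :: "'a \<Rightarrow> 'a" and S :: "(nat \<times> nat \<times> nat \<times> 'a) set"
    by force
  define Bs where "Bs = (if und then table_arcs I @ map (\<lambda>(j, u, v, q). (j, v, u, q)) (table_arcs I) else table_arcs I)"
  have Bs: "(j, u, v, q) \<in> set Bs \<longleftrightarrow> j < length (arc_table I) \<and>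
      (arc_table I ! j = (u, v, q) \<or> und \<and> arc_table I ! j = (v, u, q))" for j u v q
    by (simp add: Bs_def flip tab conj_disj_distribL)
  have "arcs_of und super I = (if super then map (\<lambda>(j, u, v, q). (j, u, v, if q < 0 then 0 else q)) Bs else Bs)"
    by (simp add: arcs_of_def Bs_def Let_def)
  moreover have "(if q < 0 then 0 else q) = max q 0" for q :: 'a by (simp add: max_def not_le)
  ultimately have "arcs_of und super I = (if super then map (\<lambda>(j, u, v, q). (j, u, v, max q 0)) Bs else Bs)"
    by simp
  then show ?thesis by (simp add: cost Bs conj_assoc)
qed

lemma sim_instance_directed:
  assumes I: "laminar_directed_input I"
    and T: "T = set (arcs_of False super I)"
    and w: "w = (if super then \<lambda>j. max (cost_of I j) 0 else cost_of I)"
  shows "sim_instance I False super T w"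
    and "path_sets T (source I) (target I) = {set p | p. pre_digraph.apath (digraph_of I) (source I) p (target I)}"
proof -
  let ?D = "digraph_of I"
  have D: "fin_digraph ?D" "conservative ?D (cost_of I)" "source I \<in> verts ?D" "source I \<noteq> target I"
    "laminar (color_family I)" "\<Union>(color_family I) = arcs ?D"
    using I by (auto simp: laminar_directed_input_def directed_input_def color_family_def)
  interpret fin_digraph ?D by (rule D(1))
  have T': "T = (\<lambda>j. (j, tail ?D j, head ?D j, w j)) ` arcs ?D"
  proof (intro set_eqI iffI)
    fix a assume "a \<in> T"
    then show "a \<in> (\<lambda>j. (j, tail ?D j, head ?D j, w j)) ` arcs ?D"
      by (cases a) (auto simp: T w arcs_of_iff digraph_of_def cost_of_def)
  next
    fix a assume "a \<in> (\<lambda>j. (j, tail ?D j, head ?D j, w j)) ` arcs ?D"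
    then obtain j where "a = (j, tail ?D j, head ?D j, w j)" "j \<in> arcs ?D" by blast
    then show "a \<in> T"
      by (cases "arc_table I ! j") (auto simp: T w arcs_of_iff digraph_of_def cost_of_def)
  qed
  have "nonneg_cycles T"
  \<comment> \<open>Truncated costs are nonnegative outright; for the original costs
    conservativeness is used.\<close>
  proof (cases super)
    case True
    then show ?thesis by (intro nonneg_cycles_nonneg) (auto simp: T' w)
  next
    case False
    then show ?thesis using nonneg_cycles_directed[OF T'] D(2) by (simp add: w)
  qed
  moreover have "consistent T" "\<And>j u v q. (j, u, v, q) \<in> T \<Longrightarrow> q = w j"
    by (auto simp: T' consistent_def)
  moreover have "\<Union>(color_family I) = {..<length (arc_table I)}" using D(6) by (simp add: digraph_of_def)
  ultimately show "sim_instance I False super T w"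
    using D(4,5) T w by (intro sim_instance.intro)
  show "path_sets T (source I) (target I) = {set p | p. pre_digraph.apath ?D (source I) p (target I)}"
    by (rule path_sets_directed[OF T' D(3)])
qed

lemma sim_instance_undirected:
  assumes I: "laminar_undirected_input I"
    and T: "T = set (arcs_of True super I)"
    and w: "w = (if super then \<lambda>j. max (cost_of I j) 0 else cost_of I)"
  shows "sim_instance I True super T w"
    and "path_sets T (source I) (target I) = {set p | p. upath (ugraph_of I) (source I) p (target I)}"
proof -
  let ?G = "ugraph_of I"
  have G: "fin_ugraph ?G" "source I \<in> uverts ?G" "source I \<noteq> target I"
    "laminar (color_family I)" "\<Union>(color_family I) = uedges ?G" "\<forall>e\<in>uedges ?G. 0 \<le> cost_of I e"
    using I by (auto simp: laminar_undirected_input_def undirected_input_def color_family_def)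
  have T': "(j, u, v, q) \<in> T \<longleftrightarrow> j \<in> uedges ?G \<and> uends ?G j = {u, v} \<and> q = w j" for j u v q
    unfolding T w
    by (cases "arc_table I ! j") (auto simp: arcs_of_iff ugraph_of_def cost_of_def doubleton_eq_iff)
  have "nonneg_cycles T"
    using G(6) by (intro nonneg_cycles_nonneg) (auto simp: T' w)
  moreover have "consistent T" "\<And>j u v q. (j, u, v, q) \<in> T \<Longrightarrow> q = w j"
    by (auto simp: T' consistent_def)
  moreover have "\<Union>(color_family I) = {..<length (arc_table I)}" using G(5) by (simp add: ugraph_of_def)
  ultimately show "sim_instance I True super T w"
    using G(3,4) T w by (intro sim_instance.intro)
  show "path_sets T (source I) (target I) = {set p | p. upath ?G (source I) p (target I)}"
    by (rule path_sets_undirected[OF T' G(1,2)])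
qed

lemma ball_color_family: "(\<forall>C\<in>color_family I. R C) \<longleftrightarrow> (\<forall>i<num_colors I. R (color_class I i))"
  by (auto simp: color_family_def)

lemma ex_path_set: "(\<exists>p. Q p \<and> A = set p) \<longleftrightarrow> A \<in> {set p | p. Q p}"
  by blast

lemma ex_path_subset: "(\<exists>p. Q p \<and> set p \<subseteq> A) \<longleftrightarrow> (\<exists>q\<in>{set p | p. Q p}. q \<subseteq> A)"
  by blast

section \<open>The four problems as instances\<close>

lemma Exact_Simultaneous_Dipaths_correct:
  assumes "laminar_directed_input I"
  shows "Exact_Simultaneous_Dipaths I (simultaneous False False I)"
proof -
  note inst = sim_instance_directed[OF assms refl refl, of False]
  interpret sim_instance I False False "set (arcs_of False False I)" "if False then \<lambda>j. max (cost_of I j) 0 else cost_of I"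
    by (rule inst(1))
  have "exact_dipaths (digraph_of I) (num_colors I) (color_class I) (source I) (target I) = exact"
    unfolding fun_eq_iff exact_dipaths_def exact_def unfolding ball_color_family inst(2) ex_path_set ex_path_subset by (simp add: digraph_of_def)
  then show ?thesis using solves_exact by (simp add: Exact_Simultaneous_Dipaths_def)
qed

lemma Superset_Simultaneous_Dipaths_correct:
  assumes "laminar_directed_input I"
  shows "Superset_Simultaneous_Dipaths I (simultaneous False True I)"
proof -
  note inst = sim_instance_directed[OF assms refl refl, of True]
  interpret sim_instance I False True "set (arcs_of False True I)" "if True then \<lambda>j. max (cost_of I j) 0 else cost_of I"
    by (rule inst(1))
  have "superset_dipaths (digraph_of I) (num_colors I) (color_class I) (source I) (target I) = superset"
    unfolding fun_eq_iff superset_dipaths_def superset_def unfolding ball_color_family inst(2) ex_path_set ex_path_subset by (simp add: digraph_of_def)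
  then show ?thesis using solves_superset by (simp add: Superset_Simultaneous_Dipaths_def)
qed

lemma Exact_Simultaneous_Paths_correct:
  assumes "laminar_undirected_input I"
  shows "Exact_Simultaneous_Paths I (simultaneous True False I)"
proof -
  note inst = sim_instance_undirected[OF assms refl refl, of False]
  interpret sim_instance I True False "set (arcs_of True False I)" "if False then \<lambda>j. max (cost_of I j) 0 else cost_of I"
    by (rule inst(1))
  have "exact_paths (ugraph_of I) (num_colors I) (color_class I) (source I) (target I) = exact"
    unfolding fun_eq_iff exact_paths_def exact_def unfolding ball_color_family inst(2) ex_path_set ex_path_subset by (simp add: ugraph_of_def)
  then show ?thesis using solves_exact by (simp add: Exact_Simultaneous_Paths_def)
qed

lemma Superset_Simultaneous_Paths_correct:
  assumes "laminar_undirected_input I"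
  shows "Superset_Simultaneous_Paths I (simultaneous True True I)"
proof -
  note inst = sim_instance_undirected[OF assms refl refl, of True]
  interpret sim_instance I True True "set (arcs_of True True I)" "if True then \<lambda>j. max (cost_of I j) 0 else cost_of I"
    by (rule inst(1))
  have "superset_paths (ugraph_of I) (num_colors I) (color_class I) (source I) (target I) = superset"
    unfolding fun_eq_iff superset_paths_def superset_def unfolding ball_color_family inst(2) ex_path_set ex_path_subset by (simp add: ugraph_of_def)
  then show ?thesis using solves_superset by (simp add: Superset_Simultaneous_Paths_def)
qed

section \<open>Sizes of rational numbers\<close>

text \<open>The maximum of the two lengths is taken because a sum of fractions carries the bits of
  both denominators in its denominator and possibly again in its numerator. Adding the lengths, as
  \<open>bit_size\<close> does, would count them twice: for \<open>1/2^k + 1/(2^k+1)\<close> it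
  yields about \<open>3 * k\<close> bits from \<open>2 * k\<close>.\<close>

definition rat_measure :: "rat \<Rightarrow> nat" where
  "rat_measure q = (case quotient_of q of (a, b) \<Rightarrow> max (floorlog 2 (nat \<bar>a\<bar>)) (floorlog 2 (nat b)))"

lemma floorlog_le_iff: "floorlog 2 n \<le> k \<longleftrightarrow> n < 2 ^ k"
proof (cases "n = 0")
  case False
  then show ?thesis using floorlog_leD[of 2 n k] floorlog_leI[of n 2 k] by auto
qed (simp add: floorlog_def)

text \<open>By coprimality the reduced numerator and denominator divide those of any other
  representation. Hence \<open>rat_measure\<close> may be estimated from an unreduced
  fraction.\<close>

lemma quotient_of_fraction:
  assumes "of_int a / of_int b = (q :: rat)" "b > 0" "quotient_of q = (m, n)"
  shows "\<bar>m\<bar> \<le> \<bar>a\<bar>" "n \<le> b" "n > 0"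
proof -
  show n: "n > 0" using assms(3) by (rule quotient_of_denom_pos)
  have "q = of_int m / of_int n" using assms(3) by (rule quotient_of_div)
  then have "(of_int (a * n) :: rat) = of_int (m * b)"
    using assms(1,2) n by (simp add: field_simps)
  then have eq: "a * n = m * b" by (simp only: of_int_eq_iff)
  have cop: "coprime m n" using assms(3) by (rule quotient_of_coprime)
  have "n dvd m * b" using eq by (metis dvd_triv_right)
  then have "n dvd b" using cop by (simp add: coprime_commute coprime_dvd_mult_right_iff)
  then show "n \<le> b" using assms(2) by (rule zdvd_imp_le)
  have "m dvd a * n" using eq by simp
  then have "m dvd a" using cop by (simp add: coprime_dvd_mult_left_iff)
  show "\<bar>m\<bar> \<le> \<bar>a\<bar>"
  proof (cases "a = 0")
    case True
    then show ?thesis using eq assms(2) by simp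
  next
    case False
    then show ?thesis using \<open>m dvd a\<close> by (simp add: dvd_imp_le_int)
  qed
qed

lemma rat_measure_le:
  assumes "quotient_of q = (a, b)" "rat_measure q \<le> k"
  shows "\<bar>a\<bar> < 2 ^ k" "b < 2 ^ k" "b > 0"
  using assms quotient_of_denom_pos[OF assms(1)]
  by (auto simp: rat_measure_def floorlog_le_iff nat_less_iff)

lemma rat_measure_leI:
  assumes "q = of_int a / of_int b" "0 < b" "\<bar>a\<bar> < 2 ^ k" "b < 2 ^ k"
  shows "rat_measure q \<le> k"
proof -
  obtain m n where mn: "quotient_of q = (m, n)" by (cases "quotient_of q")
  then show ?thesis
    using quotient_of_fraction[of a b q m n] assms
    by (auto simp: rat_measure_def floorlog_le_iff nat_less_iff)
qed

text \<open>With \<open>k\<close> and \<open>l\<close> bits, the products \<open>a * d\<close>,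
  \<open>c * b\<close> and \<open>b * d\<close> stay below \<open>2^(k+l)\<close> in absolute value.
  The extra bit is for the sum of two products in the numerator.\<close>

lemma rat_measure_add: "rat_measure (x + y) \<le> rat_measure x + rat_measure y + 1"
proof -
  obtain a b where x: "quotient_of x = (a, b)" by (cases "quotient_of x")
  obtain c d where y: "quotient_of y = (c, d)" by (cases "quotient_of y")
  let ?k = "rat_measure x" and ?l = "rat_measure y"
  note 1 = rat_measure_le[OF x order.refl] and 2 = rat_measure_le[OF y order.refl]
  show ?thesis
  proof (rule rat_measure_leI[of _ "a * d + c * b" "b * d"])
    show "x + y = of_int (a * d + c * b) / of_int (b * d)"
      using quotient_of_div[OF x] quotient_of_div[OF y] 1(3) 2(3) by (simp add: field_simps)
    show "0 < b * d" using 1(3) 2(3) by simp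
    have "b * d < 2 ^ ?k * 2 ^ ?l" using 1 2 by (intro mult_strict_mono) auto
    also have "\<dots> < 2 ^ (?k + ?l + 1)" by (simp add: power_add)
    finally show "b * d < 2 ^ (?k + ?l + 1)" .
    have "\<bar>a\<bar> * d < 2 ^ ?k * 2 ^ ?l" "b * \<bar>c\<bar> < 2 ^ ?k * 2 ^ ?l"
      using 1 2 by (intro mult_strict_mono; auto)+
    moreover have "\<bar>a * d + c * b\<bar> \<le> \<bar>a\<bar> * d + b * \<bar>c\<bar>"
      using abs_triangle_ineq[of "a * d" "c * b"] 1(3) 2(3) by (simp add: abs_mult mult.commute)
    ultimately show "\<bar>a * d + c * b\<bar> < 2 ^ (?k + ?l + 1)" by (simp add: power_add)
  qed
qed

lemma cost_model_rat: "cost_model bit_size rat_measure 1"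
proof
  show "rat_measure q \<le> bit_size q" for q
    by (auto simp: rat_measure_def bit_size_def split: prod.split)
  show "bit_size q \<le> 2 * rat_measure q" for q
    by (auto simp: rat_measure_def bit_size_def split: prod.split)
  show "rat_measure (x + y) \<le> rat_measure x + rat_measure y + 1" for x y by (rule rat_measure_add)
qed

lemma polytime_laminar:
  assumes "cost_model sz mu K"
  shows "polytime_solvable sz laminar_directed_input Exact_Simultaneous_Dipaths"
    and "polytime_solvable sz laminar_undirected_input Exact_Simultaneous_Paths"
    and "polytime_solvable sz laminar_directed_input Superset_Simultaneous_Dipaths"
    and "polytime_solvable sz laminar_undirected_input Superset_Simultaneous_Paths"
  using cost_model.polytime_simultaneous[OF assms] Exact_Simultaneous_Dipaths_correct
    Exact_Simultaneous_Paths_correct Superset_Simultaneous_Dipaths_correct Superset_Simultaneous_Paths_correct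
  by blast+

theorem theorem3p7:
  shows "polytime_solvable bit_size laminar_directed_input Exact_Simultaneous_Dipaths
       \<and> polytime_solvable bit_size laminar_undirected_input Exact_Simultaneous_Paths
       \<and> polytime_solvable bit_size laminar_directed_input Superset_Simultaneous_Dipaths
       \<and> polytime_solvable bit_size laminar_undirected_input Superset_Simultaneous_Paths
       \<and> polytime_solvable unit_size laminar_directed_input Exact_Simultaneous_Dipaths
       \<and> polytime_solvable unit_size laminar_undirected_input Exact_Simultaneous_Paths
       \<and> polytime_solvable unit_size laminar_directed_input Superset_Simultaneous_Dipaths
       \<and> polytime_solvable unit_size laminar_undirected_input Superset_Simultaneous_Paths"
  using polytime_laminar[OF cost_model_rat] polytime_laminar[OF cost_model_unit] by blast

end
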